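(* The strong cycle property is an open and dense condition: the set of $(a,b)\in\mathcal P$ for which both $a$ and $b$ have the strong cycle property is open and dense in $\mathcal P$.
   Context: $T(x)=x+1$ and $S(x)=-1/x$, acting on $\bar{\mathbb R}=\mathbb R\cup\{\infty\}$ and generating the modular group $SL(2,\mathbb Z)$ (acting by fractional linear transformations). $\mathcal P=\{(a,b)\in\mathbb R^2 : a\le 0\le b,\ b-a\ge 1,\ -ab\le 1\}$. The map $f=f_{a,b}:\bar{\mathbb R}\to\bar{\mathbb R}$ is $f(x)=x+1$ if $x<a$, $f(x)=-1/x$ if $a\le x<b$, $f(x)=x-1$ if $x\ge b$. The upper orbit of $a$ is $\{f^n(Sa)\}$, the lower orbit of $a$ is $\{f^n(Ta)\}$, the lower orbit of $b$ is $\{f^n(Sb)\}$, the upper orbit of $b$ is $\{f^n(T^{-1}b)\}$. Convention: a lower orbit hitting $a$ (resp. $b$) continues with $Ta$ (resp. $Sb$); an upper orbit hitting $a$ (resp. $b$) continues with $Sa$ (resp. $T^{-1}b$). The point $a$ has the cycle property if $f^{m_1}(Sa)=f^{k_1}(Ta)$ for some non-negative integers $m_1,k_1$, and it is strong if $T^{-1}f^{-k_1}f^{m_1}S=\mathrm{Id}$; $b$ has the cycle property if $f^{k_2}(Sb)=f^{m_2}(T^{-1}b)$ for some non-negative integers $k_2,m_2$, and it is strong if $Tf^{-m_2}f^{k_2}S=\mathrm{Id}$. In the products, powers of $f$ denote the products of $T,S,T^{-1}$ applied along the orbit, and the cycle is taken up to the first common value of the two orbits. *)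

theory Defs
  imports "HOL-Analysis.Analysis"
begin

text \<open>The extended real line with a single point at infinity (so not type \<open>ereal\<close>).\<close>

datatype rbar = Fin real | Infty

definition T_map :: "rbar \<Rightarrow> rbar" where
  "T_map x = (case x of Fin t \<Rightarrow> Fin (t + 1) | Infty \<Rightarrow> Infty)"

definition Tinv_map :: "rbar \<Rightarrow> rbar" where
  "Tinv_map x = (case x of Fin t \<Rightarrow> Fin (t - 1) | Infty \<Rightarrow> Infty)"

definition S_map :: "rbar \<Rightarrow> rbar" where
  "S_map x = (case x of Fin t \<Rightarrow> (if t = 0 then Infty else Fin (- 1 / t)) | Infty \<Rightarrow> Fin 0)"

lemma inv_T_map: "inv T_map = Tinv_map"
proof (rule inv_unique_comp)
  show "T_map \<circ> Tinv_map = id" "Tinv_map \<circ> T_map = id"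
    by (auto simp: fun_eq_iff T_map_def Tinv_map_def split: rbar.split)
qed

definition P_set :: "(real \<times> real) set" where
  "P_set = {(a, b). a \<le> 0 \<and> 0 \<le> b \<and> b - a \<ge> 1 \<and> - (a * b) \<le> 1}"

text \<open>The generator that \<open>f\<close> applies at a given point. At infinity \<open>T\<close> and its inverse both give
  \<open>f(\<infinity>) = \<infinity>\<close>; the choice made there is immaterial, since an orbit that reaches infinity stays
  there, so that a cycle taken up to the first common value never continues past it.\<close>

definition f_branch :: "real \<Rightarrow> real \<Rightarrow> rbar \<Rightarrow> (rbar \<Rightarrow> rbar)" where
  "f_branch a b x = (case x of
      Fin t \<Rightarrow> (if t < a then T_map else if t < b then S_map else Tinv_map)
    | Infty \<Rightarrow> Tinv_map)"

definition f_map :: "real \<Rightarrow> real \<Rightarrow> rbar \<Rightarrow> rbar" where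
  "f_map a b x = f_branch a b x x"

text \<open>The conventions for orbits that hit \<open>a\<close> or \<open>b\<close>, the starting point of the orbit included.\<close>

definition upper_branch :: "real \<Rightarrow> real \<Rightarrow> rbar \<Rightarrow> (rbar \<Rightarrow> rbar)" where
  "upper_branch a b x =
     (if x = Fin a then S_map else if x = Fin b then Tinv_map else f_branch a b x)"

definition lower_branch :: "real \<Rightarrow> real \<Rightarrow> rbar \<Rightarrow> (rbar \<Rightarrow> rbar)" where
  "lower_branch a b x =
     (if x = Fin a then T_map else if x = Fin b then S_map else f_branch a b x)"

lemma branch_eq_f_map:
  assumes "x \<noteq> Fin a" "x \<noteq> Fin b"
  shows "upper_branch a b x x = f_map a b x" "lower_branch a b x x = f_map a b x"
  using assms by (simp_all add: upper_branch_def lower_branch_def f_map_def)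

text \<open>\<open>orbit_word g x n\<close> is the product of the generators applied during the first \<open>n\<close> steps of the
  orbit of \<open>x\<close>, as a transformation of the extended line; \<open>orbit_pt g x n\<close> is the point reached.\<close>

primrec orbit_word :: "(rbar \<Rightarrow> (rbar \<Rightarrow> rbar)) \<Rightarrow> rbar \<Rightarrow> nat \<Rightarrow> (rbar \<Rightarrow> rbar)" where
  "orbit_word g x 0 = id"
| "orbit_word g x (Suc n) = g (orbit_word g x n x) \<circ> orbit_word g x n"

definition orbit_pt :: "(rbar \<Rightarrow> (rbar \<Rightarrow> rbar)) \<Rightarrow> rbar \<Rightarrow> nat \<Rightarrow> rbar" where
  "orbit_pt g x n = orbit_word g x n x"

definition first_common :: "(nat \<Rightarrow> rbar) \<Rightarrow> (nat \<Rightarrow> rbar) \<Rightarrow> nat \<Rightarrow> nat \<Rightarrow> bool" where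
  "first_common u l m k \<longleftrightarrow>
     u m = l k \<and> (\<forall>m'\<le>m. \<forall>k'\<le>k. u m' = l k' \<longrightarrow> m' = m \<and> k' = k)"

text \<open>Equality with \<open>id\<close> is equality of transformations, i.e. of matrices up to sign.\<close>

definition strong_cycle_a :: "real \<Rightarrow> real \<Rightarrow> bool" where
  "strong_cycle_a a b \<longleftrightarrow> (\<exists>m1 k1.
     first_common (orbit_pt (upper_branch a b) (S_map (Fin a)))
                  (orbit_pt (lower_branch a b) (T_map (Fin a))) m1 k1 \<and>
     Tinv_map \<circ> inv (orbit_word (lower_branch a b) (T_map (Fin a)) k1)
       \<circ> orbit_word (upper_branch a b) (S_map (Fin a)) m1 \<circ> S_map = id)"

definition strong_cycle_b :: "real \<Rightarrow> real \<Rightarrow> bool" where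
  "strong_cycle_b a b \<longleftrightarrow> (\<exists>k2 m2.
     first_common (orbit_pt (lower_branch a b) (S_map (Fin b)))
                  (orbit_pt (upper_branch a b) (Tinv_map (Fin b))) k2 m2 \<and>
     T_map \<circ> inv (orbit_word (upper_branch a b) (Tinv_map (Fin b)) m2)
       \<circ> orbit_word (lower_branch a b) (S_map (Fin b)) k2 \<circ> S_map = id)"

definition strong_cycle_set :: "(real \<times> real) set" where
  "strong_cycle_set = {(a, b) \<in> P_set. strong_cycle_a a b \<and> strong_cycle_b a b}"

end

theory Submission
  imports Defs
begin

text \<open>Let both orbits of \<open>a\<close> start at \<open>a\<close> itself, the upper one with the generator \<open>S\<close> and the lower
  one with \<open>T\<close>. They are kept in step by one sequence of numbers: \<open>x\<^sub>0 = -1/a\<close>, and \<open>x\<^sub>i\<^sub>+\<^sub>1\<close> is the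
  image of \<open>x\<^sub>i\<close> under the Farey map, which sends \<open>x\<close> to \<open>x - 1\<close> if \<open>x > 1\<close> and to \<open>x/(1 - x)\<close> if
  \<open>x < 1\<close>. The upper orbit passes through the points \<open>x\<^sub>i\<close> and the lower one through \<open>-1/x\<^sub>i\<close>, with
  words that differ by the factor \<open>S\<close> only (\<open>stage_Suc\<close>). This lasts as long as \<open>x\<^sub>i\<close> avoids
  the open interval \<open>(1/(1 - a), 1 + b)\<close> around \<open>1\<close>, called the hole below. When \<open>x\<^sub>N\<close> enters it
  at a point other than \<open>1\<close>, the relation \<open>(ST)\<^sup>3 = 1\<close> makes the two orbits meet a few steps later,
  with equal words. When \<open>x\<^sub>N = 1\<close>, they meet at \<open>0\<close> with different words, and when the sequence
  never reaches the hole or \<open>1\<close>, a first meeting with equal words is impossible.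

  The meeting with equal words need not be the first one. Until then the points of the
  two orbits lie in disjoint sets, except possibly for the last ones, so that an earlier meeting
  is a coincidence \<open>x\<^sub>N - 1 = 1 - 1/x\<^sub>j\<close> (for \<open>x\<^sub>N, x\<^sub>j > 1\<close>) or \<open>1 - 1/x\<^sub>N = x\<^sub>j - 1\<close> (for \<open>x\<^sub>N, x\<^sub>j < 1\<close>)
  with \<open>j < N\<close>. Such a coincidence does destroy the strong cycle property. Indeed one of the orbits
  then becomes periodic, and it remains to see that no other first meeting has equal words. This
  follows by comparing derivatives at \<open>a\<close>: each application of \<open>S\<close> at a point of absolute value
  less than \<open>1\<close> increases the derivative of a word, and translations do not change it.

  Hence, for \<open>a < 0\<close>, the point \<open>a\<close> has the strong cycle property if and only if the sequence
  enters the hole away from \<open>1\<close> and without coincidence (\<open>strong_cycle_a_iff_clean_exit\<close>); for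
  \<open>a = 0\<close> it never has the property. This condition consists of finitely many strict
  inequalities and inequations between functions that are continuous in \<open>(a, b)\<close>, so it is open
  (\<open>open_clean_set\<close>). It is also dense (\<open>clean_set_dense_near\<close>). On the one hand, if \<open>a\<close> is rational
  there are no coincidences, because numerator plus denominator of \<open>x\<^sub>i\<close> decreases along the
  Farey map, whereas both equations would make it increase. On the other hand, arbitrarily close to
  every positive number there is a rational number whose Farey orbit comes close to \<open>1\<close> without
  being equal to it, and so enters the hole.

  The reflection \<open>x \<mapsto> -x\<close> carries the situation of \<open>b\<close> to that of \<open>a\<close> for the parameters \<open>(-b, -a)\<close>,
  and two open and dense conditions have an open and dense conjunction.\<close>

section \<open>Generators and orbits\<close>

lemma generator_inverses:
  "S_map \<circ> S_map = id" "T_map \<circ> Tinv_map = id" "Tinv_map \<circ> T_map = id"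
  by (auto simp: fun_eq_iff S_map_def T_map_def Tinv_map_def split: rbar.split)

lemma bij_generators: "bij S_map" "bij T_map" "bij Tinv_map"
  using generator_inverses o_bij by blast+

lemma generators_at_point:
  "T_map (Fin z) = Fin (z + 1)" "Tinv_map (Fin z) = Fin (z - 1)"
  "z \<noteq> 0 \<Longrightarrow> S_map (Fin z) = Fin (- 1 / z)" "S_map (Fin 0) = Infty"
  "T_map Infty = Infty" "Tinv_map Infty = Infty" "S_map Infty = Fin 0"
  by (auto simp: S_map_def T_map_def Tinv_map_def)

text \<open>Three forms of the relation \<open>(ST)\<^sup>3 = 1\<close>, which is the only source of strong cycles.\<close>

lemma TSTS_eq: "T_map \<circ> S_map \<circ> T_map \<circ> S_map = S_map \<circ> Tinv_map"
proof
  fix x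
  show "(T_map \<circ> S_map \<circ> T_map \<circ> S_map) x = (S_map \<circ> Tinv_map) x"
  proof (cases x)
    case (Fin z)
    consider "z = 0" | "z = 1" | "z \<noteq> 0" "z \<noteq> 1" by blast
    then show ?thesis
    proof cases
      case 3
      then have "- 1 / z + 1 \<noteq> 0" "z - 1 \<noteq> 0" by (auto simp: field_simps)
      moreover from this 3 have "- 1 / (- 1 / z + 1) + 1 = - 1 / (z - 1)"
        by (simp add: field_simps)
      ultimately show ?thesis using 3 Fin by (simp add: generators_at_point)
    qed (auto simp: Fin generators_at_point)
  qed (simp add: generators_at_point)
qed

lemma STS_eq: "S_map \<circ> T_map \<circ> S_map = Tinv_map \<circ> S_map \<circ> Tinv_map"
proof -
  have "Tinv_map \<circ> (T_map \<circ> S_map \<circ> T_map \<circ> S_map) = Tinv_map \<circ> (S_map \<circ> Tinv_map)"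
    by (simp only: TSTS_eq)
  then show ?thesis
    by (metis comp_assoc generator_inverses(3) id_comp)
qed

lemma TS_eq: "T_map \<circ> S_map = S_map \<circ> (Tinv_map \<circ> S_map \<circ> Tinv_map)"
  unfolding STS_eq[symmetric] using generator_inverses(1) by (metis comp_assoc id_comp)

lemma generators_distinct: "T_map \<noteq> S_map" "Tinv_map \<noteq> S_map" "Tinv_map \<noteq> T_map \<circ> S_map"
proof -
  show "T_map \<noteq> S_map" "Tinv_map \<noteq> S_map"
    using generators_at_point(5,6,7) by (metis rbar.distinct(1))+
  show "Tinv_map \<noteq> T_map \<circ> S_map"
    using generators_at_point(5,6,7,1) by (metis comp_apply rbar.distinct(1))
qed

lemma orbit_pt_simps:
  "orbit_pt g x 0 = x"
  "orbit_pt g x (Suc n) = g (orbit_pt g x n) (orbit_pt g x n)"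
  by (simp_all add: orbit_pt_def)

lemma orbit_word_Suc: "orbit_word g x (Suc n) = g (orbit_pt g x n) \<circ> orbit_word g x n"
  by (simp add: orbit_pt_def)

declare orbit_word.simps(2) [simp del]

lemma orbit_word_eq_imp_pt_eq:
  "orbit_word g x m = orbit_word h x k \<Longrightarrow> orbit_pt g x m = orbit_pt h x k"
  by (simp add: orbit_pt_def)

lemma orbit_pt_shift: "orbit_pt g x (Suc n) = orbit_pt g (g x x) n"
  by (induction n) (simp_all add: orbit_pt_simps)

lemma orbit_word_shift: "orbit_word g x (Suc n) = orbit_word g (g x x) n \<circ> g x"
proof (induction n)
  case (Suc n)
  have "orbit_word g x (Suc (Suc n)) = g (orbit_pt g x (Suc n)) \<circ> orbit_word g x (Suc n)"
    by (rule orbit_word_Suc)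
  also have "\<dots> = g (orbit_pt g (g x x) n) \<circ> (orbit_word g (g x x) n \<circ> g x)"
    by (simp only: Suc orbit_pt_shift)
  finally show ?case by (simp only: orbit_word_Suc comp_assoc)
qed (simp add: orbit_pt_def orbit_word_Suc)

lemma orbit_stays_at_Infty:
  assumes "g Infty Infty = Infty" "orbit_pt g x i = Infty" "i \<le> j"
  shows "orbit_pt g x j = Infty"
  using assms(3) by (induction j rule: dec_induct) (simp_all add: assms orbit_pt_simps)

lemma orbit_pt_periodic:
  assumes "orbit_pt g x (i + d) = orbit_pt g x i"
  shows "orbit_pt g x (i + d + n) = orbit_pt g x (i + n)"
  by (induction n) (simp_all add: orbit_pt_simps assms)

lemma orbit_pt_periodic_range:
  assumes "orbit_pt g x (i + d) = orbit_pt g x i" "d > 0" "n \<ge> i"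
  shows "\<exists>n'. i \<le> n' \<and> n' < i + d \<and> orbit_pt g x n = orbit_pt g x n'"
  using assms(3)
proof (induction n rule: less_induct)
  case (less n)
  show ?case
  proof (cases "n < i + d")
    case False
    have "orbit_pt g x n = orbit_pt g x (n - d)"
      using orbit_pt_periodic[OF assms(1), of "n - d - i"] False less.prems by simp
    then show ?thesis using less.IH[of "n - d"] False assms(2) by auto
  qed (use less.prems in blast)
qed

text \<open>Both orbits attached to \<open>p\<close> start at \<open>p\<close> itself and differ in the generator applied there.
  The two definitions of the strong cycle property then become one: after at least one step
  each, the orbits first meet with the same word.\<close>

definition strong_meeting ::
  "(rbar \<Rightarrow> rbar \<Rightarrow> rbar) \<Rightarrow> (rbar \<Rightarrow> rbar \<Rightarrow> rbar) \<Rightarrow> rbar \<Rightarrow> bool" where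
  "strong_meeting g h p \<longleftrightarrow> (\<exists>m k.
     first_common (\<lambda>i. orbit_pt g p (Suc i)) (\<lambda>i. orbit_pt h p (Suc i)) m k \<and>
     orbit_word g p (Suc m) = orbit_word h p (Suc k))"

lemma branch_cases:
  "upper_branch a b x \<in> {S_map, T_map, Tinv_map}" "lower_branch a b x \<in> {S_map, T_map, Tinv_map}"
  by (auto simp: upper_branch_def lower_branch_def f_branch_def split: rbar.split)

lemma bij_orbit_word:
  assumes "\<And>x. g x \<in> {S_map, T_map, Tinv_map}"
  shows "bij (orbit_word g x n)"
proof (induction n)
  case (Suc n)
  have "bij (g y)" for y using assms[of y] bij_generators by auto
  then show ?case unfolding orbit_word_Suc using Suc by (intro bij_comp)
qed (simp add: bij_def)

lemma inv_comp_eq_id_iff: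
  assumes "bij w" "bij t"
  shows "inv t \<circ> inv w \<circ> v = id \<longleftrightarrow> v = w \<circ> t"
proof
  have "w \<circ> t \<circ> (inv t \<circ> inv w) = id"
    using assms by (auto simp: fun_eq_iff bij_is_surj surj_f_inv_f)
  then show "inv t \<circ> inv w \<circ> v = id \<Longrightarrow> v = w \<circ> t"
    by (metis comp_assoc comp_id id_comp)
  show "v = w \<circ> t \<Longrightarrow> inv t \<circ> inv w \<circ> v = id"
    using assms by (auto simp: fun_eq_iff bij_is_inj inv_f_f)
qed

lemma strong_cycle_a_iff_meeting:
  "strong_cycle_a a b \<longleftrightarrow> strong_meeting (upper_branch a b) (lower_branch a b) (Fin a)"
proof -
  have u: "upper_branch a b (Fin a) = S_map" and l: "lower_branch a b (Fin a) = T_map"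
    by (simp_all add: upper_branch_def lower_branch_def)
  have "bij (orbit_word (lower_branch a b) x k)" for x k
    by (rule bij_orbit_word) (rule branch_cases)
  then have "Tinv_map \<circ> inv (orbit_word (lower_branch a b) x k) \<circ> v \<circ> S_map = id
      \<longleftrightarrow> v \<circ> S_map = orbit_word (lower_branch a b) x k \<circ> T_map" for x k v
    using inv_comp_eq_id_iff[OF _ bij_generators(2), of "orbit_word (lower_branch a b) x k" "v \<circ> S_map"]
    by (simp add: inv_T_map comp_assoc)
  then show ?thesis
    by (simp only: strong_cycle_a_def strong_meeting_def orbit_pt_shift orbit_word_shift u l)
qed

lemma strong_cycle_b_iff_meeting:
  assumes "a \<noteq> b"
  shows "strong_cycle_b a b \<longleftrightarrow> strong_meeting (lower_branch a b) (upper_branch a b) (Fin b)"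
proof -
  have u: "upper_branch a b (Fin b) = Tinv_map" and l: "lower_branch a b (Fin b) = S_map"
    using assms by (simp_all add: upper_branch_def lower_branch_def)
  have "inv Tinv_map = T_map"
    by (rule inv_unique_comp) (simp_all add: generator_inverses)
  moreover have "bij (orbit_word (upper_branch a b) x k)" for x k
    by (rule bij_orbit_word) (rule branch_cases)
  ultimately have "T_map \<circ> inv (orbit_word (upper_branch a b) x k) \<circ> v \<circ> S_map = id
      \<longleftrightarrow> v \<circ> S_map = orbit_word (upper_branch a b) x k \<circ> Tinv_map" for x k v
    using inv_comp_eq_id_iff[OF _ bij_generators(3), of "orbit_word (upper_branch a b) x k" "v \<circ> S_map"]
    by (simp add: comp_assoc)
  then show ?thesis
    by (simp only: strong_cycle_b_def strong_meeting_def orbit_pt_shift orbit_word_shift u l)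
qed

section \<open>The reflection exchanging \<open>a\<close> and \<open>b\<close>\<close>

definition mirror :: "rbar \<Rightarrow> rbar" where
  "mirror x = (case x of Fin t \<Rightarrow> Fin (- t) | Infty \<Rightarrow> Infty)"

lemma mirror_simps: "mirror (Fin t) = Fin (- t)" "mirror Infty = Infty" "mirror (mirror x) = x"
  by (auto simp: mirror_def split: rbar.split)

lemma mirror_comp_mirror: "mirror \<circ> mirror = id"
  by (simp add: fun_eq_iff mirror_simps)

lemma mirror_conj_generators:
  "mirror \<circ> T_map \<circ> mirror = Tinv_map" "mirror \<circ> Tinv_map \<circ> mirror = T_map"
  "mirror \<circ> S_map \<circ> mirror = S_map"
  by (auto simp: fun_eq_iff mirror_def S_map_def T_map_def Tinv_map_def split: rbar.split)

lemma mirror_conj_branches: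
  assumes "a < b"
  shows "upper_branch (- b) (- a) (Fin (- t)) = mirror \<circ> lower_branch a b (Fin t) \<circ> mirror"
    and "lower_branch (- b) (- a) (Fin (- t)) = mirror \<circ> upper_branch a b (Fin t) \<circ> mirror"
  using assms
  by (auto simp: upper_branch_def lower_branch_def f_branch_def mirror_conj_generators)

text \<open>The conjugating reflections between consecutive generators cancel, provided that only generators
  at finite points are involved.\<close>

lemma orbit_word_mirror:
  assumes conj: "\<And>t. g' (Fin (- t)) = mirror \<circ> g (Fin t) \<circ> mirror"
    and fin: "\<And>i. i < n \<Longrightarrow> orbit_pt g p i \<noteq> Infty"
  shows "orbit_word g' (mirror p) n = mirror \<circ> orbit_word g p n \<circ> mirror"
  using fin
proof (induction n)
  case (Suc n)
  have IH: "orbit_word g' (mirror p) n = mirror \<circ> orbit_word g p n \<circ> mirror"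
    using Suc.IH Suc.prems less_SucI by blast
  obtain t where t: "orbit_pt g p n = Fin t" using Suc.prems[of n] by (cases "orbit_pt g p n") auto
  have "orbit_pt g' (mirror p) n = Fin (- t)"
    using IH t by (simp add: orbit_pt_def mirror_simps)
  then have "orbit_word g' (mirror p) (Suc n)
      = mirror \<circ> g (Fin t) \<circ> (mirror \<circ> mirror) \<circ> orbit_word g p n \<circ> mirror"
    by (simp only: orbit_word_Suc conj IH comp_assoc)
  then show ?case by (simp only: mirror_comp_mirror comp_id orbit_word_Suc t comp_assoc)
qed (simp add: mirror_comp_mirror)

text \<open>The generator at infinity is \<open>T\<^sup>-\<^sup>1\<close>, which is not its own mirror image. This does no
  harm: if one orbit were at infinity strictly before the first meeting point, then the meeting
  point would be infinity as well, and the pair would not be the first one.\<close>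

lemma strong_meeting_mirror:
  assumes g: "\<And>t. g' (Fin (- t)) = mirror \<circ> g (Fin t) \<circ> mirror" "g Infty Infty = Infty"
    and h: "\<And>t. h' (Fin (- t)) = mirror \<circ> h (Fin t) \<circ> mirror" "h Infty Infty = Infty"
    and meet: "strong_meeting g h (Fin p)"
  shows "strong_meeting g' h' (Fin (- p))"
proof -
  obtain m k where fc: "first_common (\<lambda>i. orbit_pt g (Fin p) (Suc i)) (\<lambda>i. orbit_pt h (Fin p) (Suc i)) m k"
    and w: "orbit_word g (Fin p) (Suc m) = orbit_word h (Fin p) (Suc k)"
    using meet by (auto simp: strong_meeting_def)
  have eq: "orbit_pt g (Fin p) (Suc m) = orbit_pt h (Fin p) (Suc k)"
    using fc by (simp add: first_common_def)
  have first: "i = m \<and> j = k" if "orbit_pt g (Fin p) (Suc i) = orbit_pt h (Fin p) (Suc j)" "i \<le> m" "j \<le> k" for i j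
    using fc that by (simp add: first_common_def)
  have fg: "orbit_pt g (Fin p) i \<noteq> Infty" if "i \<le> m" for i
  proof
    assume inf: "orbit_pt g (Fin p) i = Infty"
    then obtain i' where i': "i = Suc i'" by (cases i) (auto simp: orbit_pt_simps)
    have "orbit_pt g (Fin p) (Suc m) = Infty" using orbit_stays_at_Infty[OF g(2) inf] that by simp
    then show False using first[of i' k] i' inf eq that by auto
  qed
  have fh: "orbit_pt h (Fin p) i \<noteq> Infty" if "i \<le> k" for i
  proof
    assume inf: "orbit_pt h (Fin p) i = Infty"
    then obtain i' where i': "i = Suc i'" by (cases i) (auto simp: orbit_pt_simps)
    have "orbit_pt h (Fin p) (Suc k) = Infty" using orbit_stays_at_Infty[OF h(2) inf] that by simp
    then show False using first[of m i'] i' inf eq that by auto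
  qed
  have wg: "orbit_word g' (Fin (- p)) i = mirror \<circ> orbit_word g (Fin p) i \<circ> mirror" if "i \<le> Suc m" for i
    using orbit_word_mirror[of g' g i "Fin p", OF g(1)] fg that by (simp add: mirror_simps)
  have wh: "orbit_word h' (Fin (- p)) i = mirror \<circ> orbit_word h (Fin p) i \<circ> mirror" if "i \<le> Suc k" for i
    using orbit_word_mirror[of h' h i "Fin p", OF h(1)] fh that by (simp add: mirror_simps)
  have pg: "orbit_pt g' (Fin (- p)) i = mirror (orbit_pt g (Fin p) i)" if "i \<le> Suc m" for i
    using wg[OF that] by (simp add: orbit_pt_def mirror_simps)
  have ph: "orbit_pt h' (Fin (- p)) i = mirror (orbit_pt h (Fin p) i)" if "i \<le> Suc k" for i
    using wh[OF that] by (simp add: orbit_pt_def mirror_simps)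
  have inj: "mirror x = mirror y \<longleftrightarrow> x = y" for x y by (metis mirror_simps(3))
  have "first_common (\<lambda>i. orbit_pt g' (Fin (- p)) (Suc i)) (\<lambda>i. orbit_pt h' (Fin (- p)) (Suc i)) m k"
    using fc by (auto simp: first_common_def pg ph inj)
  moreover have "orbit_word g' (Fin (- p)) (Suc m) = orbit_word h' (Fin (- p)) (Suc k)"
    using wg[of "Suc m"] wh[of "Suc k"] w by simp
  ultimately show ?thesis by (auto simp: strong_meeting_def)
qed

lemma branch_Infty: "upper_branch a b Infty Infty = Infty" "lower_branch a b Infty Infty = Infty"
  by (simp_all add: upper_branch_def lower_branch_def f_branch_def generators_at_point)

lemma strong_cycle_b_iff_mirror:
  assumes "a < b"
  shows "strong_cycle_b a b \<longleftrightarrow> strong_cycle_a (- b) (- a)"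
proof -
  have mm: "- b < - a" using assms by simp
  show ?thesis
    unfolding strong_cycle_a_iff_meeting strong_cycle_b_iff_meeting[OF less_imp_neq[OF assms]]
    using strong_meeting_mirror[OF mirror_conj_branches(1)[OF assms] branch_Infty(2)
          mirror_conj_branches(2)[OF assms] branch_Infty(1), of b]
      strong_meeting_mirror[OF mirror_conj_branches(2)[OF mm] branch_Infty(1)
          mirror_conj_branches(1)[OF mm] branch_Infty(2), of "- b"]
    by auto
qed

section \<open>Derivatives of words along an orbit\<close>

text \<open>The derivative at \<open>p\<close> of the word of the first \<open>n\<close> steps, by the chain rule: translations have
  derivative \<open>1\<close> and \<open>S\<close> has derivative \<open>1/z\<^sup>2\<close> at \<open>z\<close>.\<close>

definition slope :: "(rbar \<Rightarrow> rbar \<Rightarrow> rbar) \<Rightarrow> real \<Rightarrow> nat \<Rightarrow> real" where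
  "slope g p n = (\<Prod>j<n. case orbit_pt g (Fin p) j of
      Fin z \<Rightarrow> if g (Fin z) = S_map then 1 / z\<^sup>2 else 1 | Infty \<Rightarrow> 1)"

text \<open>Translations are included: the point is that such a step never decreases the slope. The
  condition \<open>z \<noteq> 0\<close> keeps the orbit away from infinity, so that derivatives make
  sense.\<close>

definition expanding_step :: "(rbar \<Rightarrow> rbar \<Rightarrow> rbar) \<Rightarrow> rbar \<Rightarrow> bool" where
  "expanding_step g x \<longleftrightarrow> (\<exists>z. x = Fin z \<and>
     (g x \<in> {T_map, Tinv_map} \<or> g x = S_map \<and> z \<noteq> 0 \<and> \<bar>z\<bar> < 1))"

lemma slope_is_derivative:
  assumes "\<And>j. j < n \<Longrightarrow> expanding_step g (orbit_pt g (Fin p) j)"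
  shows "\<exists>\<phi>. (\<forall>\<^sub>F z in nhds p. orbit_word g (Fin p) n (Fin z) = Fin (\<phi> z)) \<and>
             (\<phi> has_real_derivative slope g p n) (at p)"
  using assms
proof (induction n)
  case 0
  have "((\<lambda>z. z) has_real_derivative slope g p 0) (at p)" by (simp add: slope_def)
  then show ?case by (intro exI[of _ "\<lambda>z. z"]) simp
next
  case (Suc n)
  then obtain \<phi> where ev: "\<forall>\<^sub>F z in nhds p. orbit_word g (Fin p) n (Fin z) = Fin (\<phi> z)"
    and d: "(\<phi> has_real_derivative slope g p n) (at p)" by force
  have pt: "orbit_pt g (Fin p) n = Fin (\<phi> p)"
    using eventually_nhds_x_imp_x[OF ev] by (simp add: orbit_pt_def)
  have word: "orbit_word g (Fin p) (Suc n) = g (Fin (\<phi> p)) \<circ> orbit_word g (Fin p) n"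
    by (simp only: orbit_word_Suc pt)
  have sl: "slope g p (Suc n) = slope g p n * (if g (Fin (\<phi> p)) = S_map then 1 / (\<phi> p)\<^sup>2 else 1)"
    by (simp add: slope_def pt)
  have "expanding_step g (Fin (\<phi> p))" using Suc.prems[of n] pt by simp
  then consider "g (Fin (\<phi> p)) = T_map" | "g (Fin (\<phi> p)) = Tinv_map"
    | "g (Fin (\<phi> p)) = S_map" "\<phi> p \<noteq> 0"
    by (auto simp: expanding_step_def)
  then show ?case
  proof cases
    case 1
    have "((\<lambda>z. \<phi> z + 1) has_real_derivative slope g p (Suc n)) (at p)"
      using d by (auto simp: sl 1 generators_distinct intro!: derivative_eq_intros)
    moreover have "\<forall>\<^sub>F z in nhds p. orbit_word g (Fin p) (Suc n) (Fin z) = Fin (\<phi> z + 1)"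
      using ev by eventually_elim (simp add: word 1 generators_at_point)
    ultimately show ?thesis by (intro exI[of _ "\<lambda>z. \<phi> z + 1"]) simp
  next
    case 2
    have "((\<lambda>z. \<phi> z - 1) has_real_derivative slope g p (Suc n)) (at p)"
      using d by (auto simp: sl 2 generators_distinct intro!: derivative_eq_intros)
    moreover have "\<forall>\<^sub>F z in nhds p. orbit_word g (Fin p) (Suc n) (Fin z) = Fin (\<phi> z - 1)"
      using ev by eventually_elim (simp add: word 2 generators_at_point)
    ultimately show ?thesis by (intro exI[of _ "\<lambda>z. \<phi> z - 1"]) simp
  next
    case 3
    have "isCont \<phi> p" using d by (rule DERIV_isCont)
    then have "\<forall>\<^sub>F z in nhds p. \<phi> z \<noteq> 0"
      using tendsto_imp_eventually_ne[of \<phi> "\<phi> p" "nhds p" 0] 3(2)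
      by (simp add: isCont_def tendsto_at_iff_tendsto_nhds)
    with ev have "\<forall>\<^sub>F z in nhds p. orbit_word g (Fin p) (Suc n) (Fin z) = Fin (- 1 / \<phi> z)"
      by eventually_elim (simp add: word 3 generators_at_point)
    moreover have "((\<lambda>z. - 1 / \<phi> z) has_real_derivative slope g p (Suc n)) (at p)"
      using d 3 by (auto simp: sl 3 power2_eq_square intro!: derivative_eq_intros)
    ultimately show ?thesis by (intro exI[of _ "\<lambda>z. - 1 / \<phi> z"]) simp
  qed
qed

text \<open>The tool for telling words apart: slopes can be followed along an orbit and compared.\<close>

lemma slope_eq_if_word_eq:
  assumes "orbit_word g (Fin p) m = orbit_word h (Fin p) k"
    and "\<And>j. j < m \<Longrightarrow> expanding_step g (orbit_pt g (Fin p) j)"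
    and "\<And>j. j < k \<Longrightarrow> expanding_step h (orbit_pt h (Fin p) j)"
  shows "slope g p m = slope h p k"
proof -
  obtain \<phi> \<psi> where ev: "\<forall>\<^sub>F z in nhds p. orbit_word g (Fin p) m (Fin z) = Fin (\<phi> z)"
      "\<forall>\<^sub>F z in nhds p. orbit_word h (Fin p) k (Fin z) = Fin (\<psi> z)"
    and d: "(\<phi> has_real_derivative slope g p m) (at p)" "(\<psi> has_real_derivative slope h p k) (at p)"
    using slope_is_derivative[of m g p] slope_is_derivative[of k h p] assms(2,3) by blast
  have "\<forall>\<^sub>F z in nhds p. \<phi> z = \<psi> z" using ev by eventually_elim (simp add: assms(1))
  then have "(\<phi> has_real_derivative slope h p k) (at p)" using d(2) DERIV_cong_ev by blast
  then show ?thesis using d(1) DERIV_unique by blast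
qed

lemma slope_Suc:
  assumes "orbit_pt g (Fin p) n = Fin z"
  shows "slope g p (Suc n) = slope g p n * (if g (Fin z) = S_map then 1 / z\<^sup>2 else 1)"
  by (simp add: slope_def assms)

lemma slope_pos:
  assumes "\<And>j. j < n \<Longrightarrow> expanding_step g (orbit_pt g (Fin p) j)"
  shows "slope g p n > 0"
  unfolding slope_def
proof (rule prod_pos)
  fix j assume "j \<in> {..<n}"
  then obtain z where "orbit_pt g (Fin p) j = Fin z" "g (Fin z) = S_map \<Longrightarrow> z \<noteq> 0"
    using assms[of j] generators_distinct by (auto simp: expanding_step_def)
  then show "0 < (case orbit_pt g (Fin p) j of
      Fin z \<Rightarrow> if g (Fin z) = S_map then 1 / z\<^sup>2 else 1 | Infty \<Rightarrow> 1)" by simp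
qed

lemma slope_mono:
  assumes "\<And>j. j < n \<Longrightarrow> expanding_step g (orbit_pt g (Fin p) j)" "i \<le> n"
  shows "slope g p i \<le> slope g p n"
  using assms
proof (induction n)
  case 0 then show ?case by (simp add: slope_def)
next
  case (Suc n)
  obtain z where z: "orbit_pt g (Fin p) n = Fin z" "g (Fin z) = S_map \<Longrightarrow> z \<noteq> 0 \<and> \<bar>z\<bar> < 1"
    using Suc.prems(1)[of n] generators_distinct by (auto simp: expanding_step_def)
  have "1 / z\<^sup>2 \<ge> 1" if "g (Fin z) = S_map"
    using z(2)[OF that] by (simp add: abs_square_le_1)
  then have f: "(if g (Fin z) = S_map then 1 / z\<^sup>2 else 1) \<ge> 1" by auto
  have pos: "slope g p n > 0" using slope_pos[of n g p] Suc.prems(1) by simp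
  have le: "slope g p n \<le> slope g p (Suc n)"
    using f pos by (simp add: slope_Suc[OF z(1)] mult_le_cancel_left1)
  show ?case
  proof (cases "i = Suc n")
    case False
    then show ?thesis using Suc le by force
  qed (use pos le in auto)
qed

lemma slope_strict_mono:
  assumes ex: "\<And>j. j < n \<Longrightarrow> expanding_step g (orbit_pt g (Fin p) j)"
    and "i \<le> j" "j < n" "g (orbit_pt g (Fin p) j) = S_map"
  shows "slope g p i < slope g p n"
proof -
  obtain z where z: "orbit_pt g (Fin p) j = Fin z" "z \<noteq> 0" "\<bar>z\<bar> < 1"
    using ex[OF assms(3)] assms(4) generators_distinct by (auto simp: expanding_step_def)
  have "1 / z\<^sup>2 > 1" using z by (simp add: abs_square_less_1)
  moreover have m: "slope g p i \<le> slope g p j" "slope g p j > 0" "slope g p (Suc j) \<le> slope g p n"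
    using slope_mono[of j g p i] slope_pos[of j g p] slope_mono[of n g p "Suc j"] ex assms(2,3) by auto
  ultimately have "slope g p j < slope g p (Suc j)"
    using assms(4) z(1) mult_strict_left_mono[of 1 "1 / z\<^sup>2" "slope g p j"]
    by (simp add: slope_Suc)
  then show ?thesis using m by simp
qed

section \<open>The Farey map\<close>

definition farey :: "real \<Rightarrow> real" where
  "farey x = (if x > 1 then x - 1 else if x < 1 then x / (1 - x) else 1)"

text \<open>The common parameter of the two orbits of \<open>a\<close>. It starts with the first point
  \<open>S a\<close> of the upper orbit.\<close>

definition farey_orbit :: "real \<Rightarrow> nat \<Rightarrow> real" where
  "farey_orbit a i = (farey ^^ i) (- 1 / a)"

lemma farey_orbit_simps:
  "farey_orbit a 0 = - 1 / a" "farey_orbit a (Suc i) = farey (farey_orbit a i)"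
  by (simp_all add: farey_orbit_def)

lemma farey_orbit_shift:
  assumes "farey_orbit a i = farey_orbit a j"
  shows "farey_orbit a (i + n) = farey_orbit a (j + n)"
  by (induction n) (simp_all add: farey_orbit_simps assms)

section \<open>Both orbits of \<open>a\<close> follow the Farey map\<close>

locale cf_params =
  fixes a b :: real
  assumes a_neg: "a < 0" and b_nonneg: "0 \<le> b" and gap: "b - a \<ge> 1" and prod_le: "- (a * b) \<le> 1"
begin

abbreviation "X \<equiv> farey_orbit a"
abbreviation "U \<equiv> orbit_pt (upper_branch a b) (Fin a)"
abbreviation "L \<equiv> orbit_pt (lower_branch a b) (Fin a)"
abbreviation "WU \<equiv> orbit_word (upper_branch a b) (Fin a)"
abbreviation "WL \<equiv> orbit_word (lower_branch a b) (Fin a)"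

text \<open>Lying in the hole, or at \<open>1\<close>. The point \<open>1\<close> is listed separately
  because the hole does not contain it when \<open>b = 0\<close>. The conventions for orbits hitting
  \<open>a\<close> or \<open>b\<close> make the hole open: at an endpoint the orbits go on.\<close>

definition stop :: "real \<Rightarrow> bool" where
  "stop x \<longleftrightarrow> 1 / (1 - a) < x \<and> x < 1 + b \<or> x = 1"

definition running :: "nat \<Rightarrow> bool" where
  "running i \<longleftrightarrow> (\<forall>j<i. \<not> stop (X j))"

lemma a_less_b: "a < b"
  using gap by simp

lemma b_le: "b \<le> - 1 / a"
  using prod_le a_neg by (simp add: field_simps)

lemma not_stop_cases:
  assumes "\<not> stop x"
  obtains "x > 1" "x \<ge> 1 + b" | "x < 1" "x \<le> 1 / (1 - a)"
proof -
  have "1 / (1 - a) < 1" using a_neg by simp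
  then show thesis using assms that b_nonneg by (cases "x > 1") (auto simp: stop_def)
qed

lemma running_mono: "running i \<Longrightarrow> j \<le> i \<Longrightarrow> running j"
  by (auto simp: running_def)

lemma small_bound:
  assumes "x \<le> 1 / (1 - a)" "0 < x"
  shows "x / (1 - x) \<le> - 1 / a" "x \<le> x / (1 - x)" "- 1 / x + 1 \<le> a"
proof -
  have "x * (1 - a) \<le> 1" using assms a_neg by (simp add: field_simps)
  moreover have "1 / (1 - a) < 1" using a_neg by simp
  then have "x < 1" using assms by linarith
  ultimately show "x / (1 - x) \<le> - 1 / a" "x \<le> x / (1 - x)" "- 1 / x + 1 \<le> a"
    using a_neg assms(2) by (simp_all add: field_simps)
qed

lemma running_bounds:
  assumes "running i"
  shows "b \<le> X i" "0 < X i" "X i \<le> - 1 / a"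
proof -
  have "b \<le> X i \<and> 0 < X i \<and> X i \<le> - 1 / a"
    using assms
  proof (induction i)
    case 0 then show ?case using b_le a_neg by (simp add: farey_orbit_simps)
  next
    case (Suc i)
    then have IH: "b \<le> X i" "0 < X i" "X i \<le> - 1 / a" using running_mono[of "Suc i" i] by auto
    have "\<not> stop (X i)" using Suc.prems by (simp add: running_def)
    then show ?case
    proof (cases rule: not_stop_cases)
      case 1
      then show ?thesis using IH by (auto simp: farey_orbit_simps farey_def)
    next
      case 2
      then show ?thesis using IH small_bound[OF 2(2) IH(2)]
        by (auto simp: farey_orbit_simps farey_def)
    qed
  qed
  then show "b \<le> X i" "0 < X i" "X i \<le> - 1 / a" by auto
qed

text \<open>Only parameters with \<open>-1 < a\<close> have a phase governed by the Farey map; for \<open>a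
  < -1\<close> the starting value \<open>-1/a\<close> is already in the hole.\<close>

lemma first_not_stop:
  assumes "\<not> stop (X 0)"
  shows "X 0 > 1" "- 1 < a" "0 < b"
proof -
  show "X 0 > 1" using assms
  proof (cases rule: not_stop_cases)
    case 2
    then have "- 1 / a * (1 - a) \<le> 1" using a_neg by (simp add: farey_orbit_simps field_simps)
    then have False using a_neg by (simp add: field_simps)
    then show ?thesis ..
  qed
  then show "- 1 < a" using a_neg by (simp add: farey_orbit_simps field_simps)
  then show "0 < b" using gap by simp
qed

lemma upper_branch_S: "a \<le> z \<Longrightarrow> z < b \<Longrightarrow> upper_branch a b (Fin z) = S_map"
  and upper_branch_Tinv: "b \<le> z \<Longrightarrow> upper_branch a b (Fin z) = Tinv_map"
  and lower_branch_T: "z \<le> a \<Longrightarrow> lower_branch a b (Fin z) = T_map"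
  and lower_branch_S: "a < z \<Longrightarrow> z \<le> b \<Longrightarrow> lower_branch a b (Fin z) = S_map"
  using a_less_b by (auto simp: upper_branch_def lower_branch_def f_branch_def)

lemma U_S:
  assumes "U m = Fin z" "a \<le> z" "z < b" "z \<noteq> 0"
  shows "U (Suc m) = Fin (- 1 / z)" "WU (Suc m) = S_map \<circ> WU m"
  using assms upper_branch_S
  by (simp_all add: orbit_pt_simps orbit_word_Suc generators_at_point)

lemma U_Tinv:
  assumes "U m = Fin z" "b \<le> z"
  shows "U (Suc m) = Fin (z - 1)" "WU (Suc m) = Tinv_map \<circ> WU m"
  using assms upper_branch_Tinv
  by (simp_all add: orbit_pt_simps orbit_word_Suc generators_at_point)

lemma L_T:
  assumes "L k = Fin z" "z \<le> a"
  shows "L (Suc k) = Fin (z + 1)" "WL (Suc k) = T_map \<circ> WL k"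
  using assms lower_branch_T
  by (simp_all add: orbit_pt_simps orbit_word_Suc generators_at_point)

lemma L_S:
  assumes "L k = Fin z" "a < z" "z \<le> b" "z \<noteq> 0"
  shows "L (Suc k) = Fin (- 1 / z)" "WL (Suc k) = S_map \<circ> WL k"
  using assms lower_branch_S
  by (simp_all add: orbit_pt_simps orbit_word_Suc generators_at_point)

text \<open>The values occurring on the upper orbit up to stage \<open>i\<close>: the points \<open>X
  j\<close> and, for each step with \<open>X j < 1\<close>, the two points between \<open>X j\<close> and
  \<open>X (Suc j)\<close>.\<close>

definition upper_val :: "nat \<Rightarrow> real \<Rightarrow> bool" where
  "upper_val i v \<longleftrightarrow> (\<exists>j\<le>i. v = X j) \<or>
     (\<exists>j<i. X j < 1 \<and> (v = X j - 1 \<or> v = - 1 / (X j - 1)))"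

text \<open>The index \<open>n\<close> only serves to say that the values \<open>a\<close> and \<open>a + 1\<close> coming from the starting
  point \<open>X 0\<close> occur at times \<open>0\<close> and \<open>1\<close>.\<close>

definition lower_val :: "nat \<Rightarrow> nat \<Rightarrow> real \<Rightarrow> bool" where
  "lower_val i n v \<longleftrightarrow> (\<exists>j\<le>i. v = - 1 / X j \<and> (j = 0 \<longrightarrow> n = 0)) \<or>
     (\<exists>j<i. X j > 1 \<and> (v = 1 - 1 / X j \<and> (j = 0 \<longrightarrow> n = 1) \<or> v = - 1 / (1 - 1 / X j)))"

text \<open>Stage \<open>i\<close> is reached after \<open>m\<close> upper and \<open>k\<close> lower steps.
  The clauses with \<open>upper_val\<close> and \<open>lower_val\<close> bound the set of visited values,
  which serves to exclude early meetings; the last two clauses say which values have certainly been visited,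
  which serves to produce them.\<close>

definition stage :: "nat \<Rightarrow> nat \<Rightarrow> nat \<Rightarrow> bool" where
  "stage i m k \<longleftrightarrow> i < m \<and> i \<le> k \<and> U m = Fin (X i) \<and> L k = Fin (- 1 / X i) \<and>
     WL k = S_map \<circ> WU m \<and>
     (\<forall>n. 1 \<le> n \<and> n \<le> m \<longrightarrow> (\<exists>v. U n = Fin v \<and> upper_val i v)) \<and>
     (\<forall>n\<le>k. \<exists>v. L n = Fin v \<and> lower_val i n v) \<and>
     (\<forall>j<i. X j < 1 \<longrightarrow> (\<exists>n. 1 \<le> n \<and> n \<le> m \<and> U n = Fin (X j - 1))) \<and>
     (\<forall>j<i. X j > 1 \<longrightarrow> (\<exists>n. 1 \<le> n \<and> n \<le> k \<and> L n = Fin (1 - 1 / X j)))"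

lemma upper_val_Suc: "upper_val i v \<Longrightarrow> upper_val (Suc i) v"
  unfolding upper_val_def by (blast intro: le_SucI less_SucI)

lemma lower_val_Suc: "lower_val i n v \<Longrightarrow> lower_val (Suc i) n v"
  unfolding lower_val_def by (blast intro: le_SucI less_SucI)

lemma stage_0: "stage 0 1 0"
proof -
  have u: "U 0 = Fin a" by (simp add: orbit_pt_simps)
  have 1: "upper_branch a b (Fin a) = S_map" using upper_branch_S a_less_b by simp
  have U1: "U 1 = Fin (- 1 / a)" using a_neg 1 by (simp add: orbit_pt_simps generators_at_point)
  have WU1: "WU 1 = S_map" using 1 by (simp add: orbit_word_Suc orbit_pt_simps)
  have "upper_val 0 (- 1 / a)" "lower_val 0 0 a"
    using a_neg by (simp_all add: upper_val_def lower_val_def farey_orbit_simps)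
  moreover have "n = 1" if "1 \<le> n" "n \<le> 1" for n :: nat using that by simp
  ultimately show ?thesis
    using U1 WU1 a_neg generator_inverses(1)
    by (auto simp: stage_def farey_orbit_simps orbit_pt_simps(1) intro!: exI[of _ "- 1 / a"])
qed

lemma stage_0_k:
  assumes "stage 0 m k" shows "k = 0"
  using assms unfolding stage_def lower_val_def by auto

lemma big_values:
  assumes "1 < x" "x \<le> - 1 / a"
  shows "0 < 1 - 1 / x" "1 - 1 / x \<le> a + 1" "- 1 / (1 - 1 / x) < a"
proof -
  have "- 1 / x \<le> a" using assms a_neg by (simp add: field_simps)
  then show y: "0 < 1 - 1 / x" "1 - 1 / x \<le> a + 1" using assms by auto
  have "1 - 1 / x < 1" using assms by simp
  then have "- 1 / (1 - 1 / x) < - 1" using y(1) by (simp add: field_simps)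
  moreover have "- 1 < a" using y by linarith
  ultimately show "- 1 / (1 - 1 / x) < a" by linarith
qed

lemma neg_inverse_le:
  assumes "0 < x" "x \<le> - 1 / a"
  shows "- 1 / x \<le> a"
  using assms a_neg by (simp add: field_simps)

lemma small_values:
  assumes "x < 1" "b \<le> x"
  shows "a \<le> x - 1" "- 1 / a \<le> - 1 / (x - 1)"
proof -
  show "a \<le> x - 1" using assms gap by linarith
  moreover have "x - 1 < 0" using assms by simp
  ultimately show "- 1 / a \<le> - 1 / (x - 1)" using a_neg by (simp add: divide_simps)
qed

text \<open>A Farey step to the right of \<open>1\<close> is the single generator
  \<open>T\<^sup>-\<^sup>1\<close> on the upper orbit and the word \<open>TST\<close> on the lower
  one.\<close>

lemma big_step:
  assumes s: "U m = Fin x" "L k = Fin (- 1 / x)" and x: "1 < x" "b \<le> x" "x \<le> - 1 / a"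
  shows "U (Suc m) = Fin (x - 1)" "WU (Suc m) = Tinv_map \<circ> WU m"
    "L (Suc k) = Fin (1 - 1 / x)" "L (Suc (Suc k)) = Fin (- 1 / (1 - 1 / x))"
    "L (Suc (Suc (Suc k))) = Fin (- 1 / (x - 1))"
    "WL (Suc (Suc (Suc k))) = T_map \<circ> S_map \<circ> T_map \<circ> WL k"
proof -
  have ya: "- 1 / x \<le> a" using neg_inverse_le x by simp
  note y = big_values[OF x(1,3)]
  show "U (Suc m) = Fin (x - 1)" "WU (Suc m) = Tinv_map \<circ> WU m"
    using U_Tinv[OF s(1)] x by auto
  have e: "- 1 / x + 1 = 1 - 1 / x" by simp
  note l1 = L_T[OF s(2) ya, unfolded e]
  have "a < 1 - 1 / x" "1 - 1 / x \<le> b" "1 - 1 / x \<noteq> 0" using y(1,2) a_neg gap by linarith+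
  note l2 = L_S[OF l1(1) this]
  note l3 = L_T[OF l2(1) less_imp_le[OF y(3)]]
  have "- 1 / (1 - 1 / x) + 1 = - 1 / (x - 1)" using x by (simp add: field_simps)
  then show "L (Suc (Suc (Suc k))) = Fin (- 1 / (x - 1))" using l3(1) by simp
  show "L (Suc k) = Fin (1 - 1 / x)" "L (Suc (Suc k)) = Fin (- 1 / (1 - 1 / x))"
    using l1 l2 by auto
  show "WL (Suc (Suc (Suc k))) = T_map \<circ> S_map \<circ> T_map \<circ> WL k"
    by (simp only: l1 l2 l3 comp_assoc)
qed

text \<open>A Farey step to the left of \<open>1\<close> is the word
  \<open>T\<^sup>-\<^sup>1ST\<^sup>-\<^sup>1\<close> on the upper orbit and the single generator
  \<open>T\<close> on the lower one.\<close>

lemma small_step: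
  assumes s: "U m = Fin x" "L k = Fin (- 1 / x)" and x: "0 < x" "x < 1" "b \<le> x" "x \<le> - 1 / a"
  shows "U (Suc m) = Fin (x - 1)" "U (Suc (Suc m)) = Fin (- 1 / (x - 1))"
    "U (Suc (Suc (Suc m))) = Fin (- 1 / (1 - 1 / x))"
    "WU (Suc (Suc m)) = S_map \<circ> Tinv_map \<circ> WU m"
    "WU (Suc (Suc (Suc m))) = Tinv_map \<circ> S_map \<circ> Tinv_map \<circ> WU m"
    "L (Suc k) = Fin (1 - 1 / x)" "WL (Suc k) = T_map \<circ> WL k"
proof -
  have ya: "- 1 / x \<le> a" using neg_inverse_le x by simp
  have e: "- 1 / x + 1 = 1 - 1 / x" by simp
  note l1 = L_T[OF s(2) ya, unfolded e]
  show "L (Suc k) = Fin (1 - 1 / x)" "WL (Suc k) = T_map \<circ> WL k" using l1 by auto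
  note t = small_values[OF x(2,3)]
  note u1 = U_Tinv[OF s(1) x(3)]
  have "x - 1 < b" "x - 1 \<noteq> 0" using x b_nonneg by auto
  note u2 = U_S[OF u1(1) t(1) this]
  have "b \<le> - 1 / (x - 1)" using t(2) b_le by linarith
  note u3 = U_Tinv[OF u2(1) this]
  have "- 1 / (x - 1) - 1 = - 1 / (1 - 1 / x)" using x by (simp add: field_simps)
  then show "U (Suc (Suc (Suc m))) = Fin (- 1 / (1 - 1 / x))" using u3 by simp
  show "U (Suc m) = Fin (x - 1)" "U (Suc (Suc m)) = Fin (- 1 / (x - 1))"
    using u1 u2 by auto
  show "WU (Suc (Suc m)) = S_map \<circ> Tinv_map \<circ> WU m"
    by (simp only: u1 u2 comp_assoc)
  show "WU (Suc (Suc (Suc m))) = Tinv_map \<circ> S_map \<circ> Tinv_map \<circ> WU m"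
    by (simp only: u1 u2 u3 comp_assoc)
qed

lemma stage_Suc:
  assumes st: "stage i m k" and run: "running (Suc i)"
  shows "\<exists>m' k'. stage (Suc i) m' k'"
proof -
  have bd: "b \<le> X i" "0 < X i" "X i \<le> - 1 / a"
    using running_bounds running_mono[OF run, of i] by auto
  have U: "U m = Fin (X i)" and L: "L k = Fin (- 1 / X i)" and w: "WL k = S_map \<circ> WU m"
    and im: "i < m" "i \<le> k"
    and uv: "\<And>n. 1 \<le> n \<Longrightarrow> n \<le> m \<Longrightarrow> \<exists>v. U n = Fin v \<and> upper_val i v"
    and lv: "\<And>n. n \<le> k \<Longrightarrow> \<exists>v. L n = Fin v \<and> lower_val i n v"
    and uh: "\<And>j. j < i \<Longrightarrow> X j < 1 \<Longrightarrow> \<exists>n. 1 \<le> n \<and> n \<le> m \<and> U n = Fin (X j - 1)"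
    and lh: "\<And>j. j < i \<Longrightarrow> X j > 1 \<Longrightarrow> \<exists>n. 1 \<le> n \<and> n \<le> k \<and> L n = Fin (1 - 1 / X j)"
    using st by (auto simp: stage_def)
  have k0: "k = 0" if "i = 0" using stage_0_k st that by simp
  have "\<not> stop (X i)" using run by (simp add: running_def)
  then show ?thesis
  proof (cases rule: not_stop_cases)
    case 1
    note bs = big_step[OF U L 1(1) bd(1,3)]
    have Xs: "X (Suc i) = X i - 1" using 1 by (simp add: farey_orbit_simps farey_def)
    have "stage (Suc i) (Suc m) (Suc (Suc (Suc k)))"
      unfolding stage_def
    proof (intro conjI allI impI)
      have "WL (Suc (Suc (Suc k))) = (T_map \<circ> S_map \<circ> T_map \<circ> S_map) \<circ> WU m"
        by (simp only: bs w comp_assoc)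
      also have "\<dots> = (S_map \<circ> Tinv_map) \<circ> WU m" by (simp only: TSTS_eq)
      finally show "WL (Suc (Suc (Suc k))) = S_map \<circ> WU (Suc m)"
        by (simp only: bs comp_assoc)
    next
      fix n assume n: "1 \<le> n \<and> n \<le> Suc m"
      show "\<exists>v. U n = Fin v \<and> upper_val (Suc i) v"
      proof (cases "n \<le> m")
        case True then show ?thesis using uv[of n] n upper_val_Suc by blast
      next
        case False
        then have "n = Suc m" using n by simp
        then show ?thesis using bs(1) Xs by (auto simp: upper_val_def)
      qed
    next
      fix n assume n: "n \<le> Suc (Suc (Suc k))"
      consider "n \<le> k" | "n = Suc k" | "n = Suc (Suc k)" | "n = Suc (Suc (Suc k))"
        using n by linarith
      then show "\<exists>v. L n = Fin v \<and> lower_val (Suc i) n v"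
      proof cases
        case 1 then show ?thesis using lv[of n] lower_val_Suc by blast
      next
        case 2
        have "lower_val (Suc i) n (1 - 1 / X i)"
          unfolding lower_val_def using \<open>1 < X i\<close> 2 k0 by (intro disjI2 exI[of _ i]) auto
        then show ?thesis using 2 bs by auto
      next
        case 3
        have "lower_val (Suc i) n (- 1 / (1 - 1 / X i))"
          unfolding lower_val_def using \<open>1 < X i\<close> by (intro disjI2 exI[of _ i]) auto
        then show ?thesis using 3 bs by auto
      next
        case 4
        have "lower_val (Suc i) n (- 1 / X (Suc i))"
          unfolding lower_val_def by (intro disjI1 exI[of _ "Suc i"]) auto
        then show ?thesis using 4 bs Xs by auto
      qed
    next
      fix j assume "j < Suc i" "X j < 1"
      then have "j < i" using 1 by (auto simp: less_Suc_eq)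
      then show "\<exists>n. 1 \<le> n \<and> n \<le> Suc m \<and> U n = Fin (X j - 1)" using uh[of j] \<open>X j < 1\<close>
        using le_Suc_eq by blast
    next
      fix j assume j: "j < Suc i" "X j > 1"
      show "\<exists>n. 1 \<le> n \<and> n \<le> Suc (Suc (Suc k)) \<and> L n = Fin (1 - 1 / X j)"
      proof (cases "j = i")
        case True then show ?thesis using bs by (intro exI[of _ "Suc k"]) auto
      next
        case False then show ?thesis using lh[of j] j le_Suc_eq by (metis less_SucE)
      qed
    qed (use bs Xs im in auto)
    then show ?thesis by blast
  next
    case 2
    note ss = small_step[OF U L bd(2) 2(1) bd(1,3)]
    have Xs: "X (Suc i) = X i / (1 - X i)" using 2 by (simp add: farey_orbit_simps farey_def)
    have Xs': "- 1 / (1 - 1 / X i) = X (Suc i)" "- 1 / X (Suc i) = 1 - 1 / X i"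
      unfolding Xs using 2 bd by (simp_all add: field_simps)
    have "stage (Suc i) (Suc (Suc (Suc m))) (Suc k)"
      unfolding stage_def
    proof (intro conjI allI impI)
      have "WL (Suc k) = (T_map \<circ> S_map) \<circ> WU m"
        by (simp only: ss w comp_assoc)
      then show "WL (Suc k) = S_map \<circ> WU (Suc (Suc (Suc m)))"
        by (simp only: TS_eq ss comp_assoc)
    next
      fix n assume n: "1 \<le> n \<and> n \<le> Suc (Suc (Suc m))"
      consider "n \<le> m" | "n = Suc m" | "n = Suc (Suc m)" | "n = Suc (Suc (Suc m))"
        using n by linarith
      then show "\<exists>v. U n = Fin v \<and> upper_val (Suc i) v"
      proof cases
        case 1 then show ?thesis using uv[of n] n upper_val_Suc by blast
      next
        case 2
        have "upper_val (Suc i) (X i - 1)"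
          unfolding upper_val_def using \<open>X i < 1\<close> by (intro disjI2 exI[of _ i]) auto
        then show ?thesis using 2 ss by auto
      next
        case 3
        have "upper_val (Suc i) (- 1 / (X i - 1))"
          unfolding upper_val_def using \<open>X i < 1\<close> by (intro disjI2 exI[of _ i]) auto
        then show ?thesis using 3 ss by auto
      next
        case 4
        have "upper_val (Suc i) (X (Suc i))" by (auto simp: upper_val_def)
        then show ?thesis using 4 ss Xs' by auto
      qed
    next
      fix n assume n: "n \<le> Suc k"
      show "\<exists>v. L n = Fin v \<and> lower_val (Suc i) n v"
      proof (cases "n \<le> k")
        case True then show ?thesis using lv[of n] lower_val_Suc by blast
      next
        case False
        then have n': "n = Suc k" using n by simp
        have "lower_val (Suc i) n (- 1 / X (Suc i))"
          unfolding lower_val_def by (intro disjI1 exI[of _ "Suc i"]) auto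
        then show ?thesis using n' ss Xs' by auto
      qed
    next
      fix j assume j: "j < Suc i" "X j < 1"
      show "\<exists>n. 1 \<le> n \<and> n \<le> Suc (Suc (Suc m)) \<and> U n = Fin (X j - 1)"
      proof (cases "j = i")
        case True then show ?thesis using ss by (intro exI[of _ "Suc m"]) auto
      next
        case False then show ?thesis using uh[of j] j le_Suc_eq by (metis less_SucE)
      qed
    next
      fix j assume "j < Suc i" "X j > 1"
      then have "j < i" using 2 by (auto simp: less_Suc_eq)
      then show "\<exists>n. 1 \<le> n \<and> n \<le> Suc k \<and> L n = Fin (1 - 1 / X j)" using lh[of j] \<open>X j > 1\<close>
        using le_Suc_eq by blast
    qed (use ss Xs' im in auto)
    then show ?thesis by blast
  qed
qed

lemma stage_exists: "running i \<Longrightarrow> \<exists>m k. stage i m k"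
proof (induction i)
  case 0 show ?case using stage_0 by blast
next
  case (Suc i)
  then obtain m k where "stage i m k" using running_mono[of "Suc i" i] by auto
  then show ?case using stage_Suc Suc.prems by blast
qed

end

section \<open>Coincidences and exits from the Farey phase\<close>

text \<open>No coincidence between the values coming from \<open>X i\<close> and \<open>X j\<close>: in the
  first clause \<open>X i - 1\<close> is a point of the upper orbit and \<open>1 - 1/X j\<close> one of the
  lower orbit, in the second clause it is the other way round.\<close>

definition separated :: "real \<Rightarrow> nat \<Rightarrow> nat \<Rightarrow> bool" where
  "separated a i j \<longleftrightarrow>
     (farey_orbit a i > 1 \<and> farey_orbit a j > 1 \<longrightarrow> farey_orbit a i - 1 \<noteq> 1 - 1 / farey_orbit a j) \<and>
     (farey_orbit a i < 1 \<and> farey_orbit a j < 1 \<longrightarrow> 1 - 1 / farey_orbit a i \<noteq> farey_orbit a j - 1)"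

text \<open>Coincidences matter at the first time in the hole; at earlier times separation holds
  automatically (\<open>separated_before\<close>). Demanding it for all \<open>i \<le> n\<close> has the
  effect that \<open>n\<close> can be any time in the hole, which makes the condition visibly open in
  \<open>(a, b)\<close>.\<close>

definition clean_exit :: "real \<Rightarrow> real \<Rightarrow> bool" where
  "clean_exit a b \<longleftrightarrow> (\<exists>n. 1 / (1 - a) < farey_orbit a n \<and> farey_orbit a n < 1 + b \<and>
     farey_orbit a n \<noteq> 1 \<and> (\<forall>i\<le>n. \<forall>j<i. separated a i j))"

context cf_params
begin

text \<open>As long as the sequence has not stopped, the upper orbit stays in the first and the lower orbit
  in the second of two disjoint sets, apart from the exceptional values \<open>a\<close> and \<open>a +
  1\<close> of the upper orbit, which require \<open>b = a + 1\<close>.\<close>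

definition in_upper_part :: "real \<Rightarrow> bool" where
  "in_upper_part v \<longleftrightarrow> v > a + 1 \<or> a < v \<and> v < 0"

definition in_lower_part :: "real \<Rightarrow> bool" where
  "in_lower_part v \<longleftrightarrow> v \<le> a \<or> 0 < v \<and> v \<le> a + 1"

lemma parts_disjoint: "in_lower_part v \<Longrightarrow> \<not> in_upper_part v"
  using a_neg by (auto simp: in_upper_part_def in_lower_part_def)

lemma neg_inverse_a_gt: "a + 1 < - 1 / a"
proof -
  have "0 < (a + 1/2)\<^sup>2 + 3/4" by (simp add: add_nonneg_pos)
  also have "\<dots> = a * a + a + 1" by (simp add: power2_eq_square algebra_simps)
  finally show ?thesis using a_neg by (simp add: field_simps)
qed

lemma lower_val_in_lower_part:
  assumes "running i" "lower_val i n v"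
  shows "in_lower_part v"
  using assms(2) unfolding lower_val_def
proof (elim disjE exE conjE)
  fix j assume "j \<le> i" "v = - 1 / X j"
  then show ?thesis
    using running_bounds running_mono[OF assms(1)] neg_inverse_le by (simp add: in_lower_part_def)
next
  fix j assume "j < i" "X j > 1" "v = 1 - 1 / X j"
  then show ?thesis
    using big_values(1,2)[of "X j"] running_bounds(3)[of j] running_mono[OF assms(1), of j]
    by (simp add: in_lower_part_def)
next
  fix j assume "j < i" "X j > 1" "v = - 1 / (1 - 1 / X j)"
  then show ?thesis
    using big_values(3)[of "X j"] running_bounds(3)[of j] running_mono[OF assms(1), of j]
    by (simp add: in_lower_part_def)
qed

lemma upper_val_cases:
  assumes "running i" "upper_val i v"
  shows "v \<noteq> 0" "a \<le> v" "v < b \<Longrightarrow> v < 0"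
    "in_upper_part v \<or> (v = a \<or> v = a + 1) \<and> (\<exists>j\<le>i. X j = a + 1)"
proof -
  have "v \<noteq> 0 \<and> a \<le> v \<and> (v < b \<longrightarrow> v < 0) \<and>
    (in_upper_part v \<or> (v = a \<or> v = a + 1) \<and> (\<exists>j\<le>i. X j = a + 1))"
    using assms(2) unfolding upper_val_def
  proof (elim disjE exE conjE)
    fix j assume j: "j \<le> i" "v = X j"
    have "b \<le> X j" "0 < X j" using running_bounds running_mono[OF assms(1) j(1)] by auto
    then show ?thesis using gap a_neg j by (auto simp: in_upper_part_def)
  next
    fix j assume j: "j < i" "X j < 1" "v = X j - 1"
    have "b \<le> X j" "0 < X j" using running_bounds running_mono[OF assms(1), of j] j by auto
    then show ?thesis using small_values(1)[of "X j"] j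
      by (auto simp: in_upper_part_def intro!: exI[of _ j])
  next
    fix j assume j: "j < i" "X j < 1" "v = - 1 / (X j - 1)"
    have "b \<le> X j" "0 < X j" using running_bounds running_mono[OF assms(1), of j] j by auto
    then have "v \<ge> - 1 / a" using small_values(2)[of "X j"] j by simp
    then show ?thesis using neg_inverse_a_gt b_le b_nonneg gap a_neg
      by (auto simp: in_upper_part_def)
  qed
  then show "v \<noteq> 0" "a \<le> v" "v < b \<Longrightarrow> v < 0"
    "in_upper_part v \<or> (v = a \<or> v = a + 1) \<and> (\<exists>j\<le>i. X j = a + 1)" by auto
qed

lemma upper_val_in_upper_part:
  assumes "running i" "upper_val i v" "\<And>j. j \<le> i \<Longrightarrow> X j \<noteq> a + 1"
  shows "in_upper_part v"
  using upper_val_cases(4)[OF assms(1,2)] assms(3) by blast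

text \<open>A return would make the sequence periodic, and it would never stop.\<close>

lemma no_return_to_start:
  assumes "running N" "stop (X N)" "1 \<le> j" "j \<le> N"
  shows "X j \<noteq> X 0"
proof
  assume "X j = X 0"
  then have "X (j + (N - j)) = X (0 + (N - j))" by (rule farey_orbit_shift)
  then have "X N = X (N - j)" using assms by simp
  then show False using assms by (auto simp: running_def)
qed

text \<open>The Farey map sends both \<open>a + 1\<close> and \<open>-1/a\<close> to \<open>-1/a -
  1\<close>. So hitting \<open>a + 1\<close> makes the sequence periodic as well. This excludes the
  exceptional values for sequences that stop.\<close>

lemma no_hit_a_plus_1:
  assumes "running N" "stop (X N)" "j \<le> N"
  shows "X j \<noteq> a + 1"
proof
  assume j: "X j = a + 1"
  have j0: "j \<noteq> 0" using j neg_inverse_a_gt by (auto simp: farey_orbit_simps intro: ccontr)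
  then have "\<not> stop (X 0)" using assms by (auto simp: running_def)
  then have a1: "- 1 < a" by (rule first_not_stop)
  have "X 0 > 1" using \<open>\<not> stop (X 0)\<close> by (rule first_not_stop)
  have "(a + 1) * (1 - a) < 1" using a_neg by (simp add: algebra_simps mult_neg_neg)
  then have "a + 1 < 1 / (1 - a)" using a_neg by (simp add: field_simps)
  then have "\<not> stop (a + 1)" using a_neg by (simp add: stop_def)
  then have "j < N" using assms j by (metis le_neq_implies_less)
  have "X (Suc j) = X 1"
    using j a_neg a1 \<open>X 0 > 1\<close> by (simp add: farey_orbit_simps farey_def field_simps)
  then have "X (Suc j + (N - Suc j)) = X (1 + (N - Suc j))" by (rule farey_orbit_shift)
  then have "X N = X (N - j)" using \<open>j < N\<close> by (simp add: Suc_diff_Suc)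
  then show False using assms j0 \<open>j < N\<close> by (auto simp: running_def)
qed

text \<open>In terms of orbits starting at \<open>a\<close> itself, whence the times are at least
  \<open>1\<close>.\<close>

definition strong_pair :: "nat \<Rightarrow> nat \<Rightarrow> bool" where
  "strong_pair m k \<longleftrightarrow> 1 \<le> m \<and> 1 \<le> k \<and> WU m = WL k \<and>
     (\<forall>m' k'. 1 \<le> m' \<and> m' \<le> m \<and> 1 \<le> k' \<and> k' \<le> k \<and> U m' = L k' \<longrightarrow> m' = m \<and> k' = k)"

lemma strong_cycle_a_iff_pair: "strong_cycle_a a b \<longleftrightarrow> (\<exists>m k. strong_pair m k)"
proof
  assume "strong_cycle_a a b"
  then obtain m k where mk: "first_common (\<lambda>i. U (Suc i)) (\<lambda>i. L (Suc i)) m k" "WU (Suc m) = WL (Suc k)"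
    by (auto simp: strong_cycle_a_iff_meeting strong_meeting_def)
  have "strong_pair (Suc m) (Suc k)"
    unfolding strong_pair_def
  proof (intro conjI allI impI)
    fix m' k' assume h: "1 \<le> m' \<and> m' \<le> Suc m \<and> 1 \<le> k' \<and> k' \<le> Suc k \<and> U m' = L k'"
    then obtain i j where "m' = Suc i" "k' = Suc j" by (metis Suc_le_D One_nat_def)
    then show "m' = Suc m" "k' = Suc k" using mk(1) h by (auto simp: first_common_def)
  qed (use mk in auto)
  then show "\<exists>m k. strong_pair m k" by blast
next
  assume "\<exists>m k. strong_pair m k"
  then obtain m k where mk: "strong_pair m k" by blast
  then obtain i j where ij: "m = Suc i" "k = Suc j"
    unfolding strong_pair_def by (metis Suc_le_D One_nat_def)
  have "U m = L k" using mk orbit_word_eq_imp_pt_eq unfolding strong_pair_def by blast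
  then have "first_common (\<lambda>i. U (Suc i)) (\<lambda>i. L (Suc i)) i j"
    using mk unfolding strong_pair_def first_common_def ij by fastforce
  then show "strong_cycle_a a b"
    using mk ij by (auto simp: strong_cycle_a_iff_meeting strong_meeting_def strong_pair_def)
qed

lemma stageD:
  assumes "stage i m k"
  shows "i < m" "i \<le> k" "U m = Fin (X i)" "L k = Fin (- 1 / X i)" "WL k = S_map \<circ> WU m"
    "\<And>n. 1 \<le> n \<Longrightarrow> n \<le> m \<Longrightarrow> \<exists>v. U n = Fin v \<and> upper_val i v"
    "\<And>n. n \<le> k \<Longrightarrow> \<exists>v. L n = Fin v \<and> lower_val i n v"
    "\<And>j. j < i \<Longrightarrow> X j < 1 \<Longrightarrow> \<exists>n. 1 \<le> n \<and> n \<le> m \<and> U n = Fin (X j - 1)"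
    "\<And>j. j < i \<Longrightarrow> X j > 1 \<Longrightarrow> \<exists>n. 1 \<le> n \<and> n \<le> k \<and> L n = Fin (1 - 1 / X j)"
  using assms by (auto simp: stage_def)

end

text \<open>The end of the Farey phase: \<open>X N\<close> is the first point in the hole, and it is not \<open>1\<close>.\<close>

locale exit_stage = cf_params +
  fixes N m k :: nat
  assumes run: "running N" and stp: "stop (X N)" and st: "stage N m k" and ne1: "X N \<noteq> 1"
begin

lemmas bd = running_bounds[OF run]
lemmas sd = stageD[OF st]

lemma in_hole: "1 / (1 - a) < X N" "X N < 1 + b"
  using stp ne1 by (auto simp: stop_def)

lemma bd_le: "j \<le> N \<Longrightarrow> b \<le> X j \<and> 0 < X j \<and> X j \<le> - 1 / a"
  using running_bounds running_mono[OF run] by blast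

lemma U_upper: "1 \<le> n \<Longrightarrow> n \<le> m \<Longrightarrow> \<exists>v. U n = Fin v \<and> in_upper_part v"
  using sd(6)[of n] upper_val_in_upper_part[OF run] no_hit_a_plus_1[OF run stp] by blast

lemma L_lower: "n \<le> k \<Longrightarrow> \<exists>v. L n = Fin v \<and> in_lower_part v"
  using sd(7)[of n] lower_val_in_lower_part[OF run] by blast

lemma disjoint_points:
  assumes "\<exists>v. U i = Fin v \<and> in_upper_part v" "\<exists>v. L j = Fin v \<and> in_lower_part v"
  shows "U i \<noteq> L j"
  using assms parts_disjoint by auto

end

text \<open>With \<open>t = X N - 1\<close>, what distinguishes the hole is \<open>t < b\<close>: the next
  generator of the upper orbit is \<open>S\<close> instead of \<open>T\<^sup>-\<^sup>1\<close>. The lower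
  orbit makes the same steps as before.\<close>

locale big_exit = exit_stage +
  assumes gt1: "X N > 1"
begin

definition t :: real where "t = X N - 1"

lemma t_bounds: "0 < t" "t < b" "- 1 / t < a"
proof -
  show t: "0 < t" "t < b" using gt1 in_hole by (auto simp: t_def)
  then have "t < - 1 / a" using b_le by linarith
  then show "- 1 / t < a" using t a_neg by (simp add: field_simps)
qed

lemmas bs = big_step[OF sd(3,4) gt1 bd(1,3), folded t_def]
lemmas bv = big_values[OF gt1 bd(3)]

lemma U_end: "U (Suc (Suc m)) = Fin (- 1 / t)" "WU (Suc (Suc m)) = S_map \<circ> WU (Suc m)"
  using U_S[OF bs(1)] t_bounds a_neg by auto

lemma words_agree: "WU (Suc (Suc m)) = WL (Suc (Suc (Suc k)))"
proof -
  have "WL (Suc (Suc (Suc k))) = (T_map \<circ> S_map \<circ> T_map \<circ> S_map) \<circ> WU m"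
    by (simp only: bs sd(5) comp_assoc)
  also have "\<dots> = (S_map \<circ> Tinv_map) \<circ> WU m" by (simp only: TSTS_eq)
  also have "\<dots> = WU (Suc (Suc m))" by (simp only: bs U_end comp_assoc)
  finally show ?thesis ..
qed

lemma L_lower_end: "n \<le> Suc (Suc (Suc k)) \<Longrightarrow> \<exists>v. L n = Fin v \<and> in_lower_part v"
proof -
  assume "n \<le> Suc (Suc (Suc k))"
  then consider "n \<le> k" | "n = Suc k" | "n = Suc (Suc k)" | "n = Suc (Suc (Suc k))" by linarith
  then show ?thesis
    by cases (use L_lower bs bv t_bounds in \<open>auto simp: in_lower_part_def\<close>)
qed

text \<open>The two additional steps are of the same shape as the earlier ones, with \<open>j =
  N\<close>.\<close>

lemma L_vals:
  assumes "n \<le> Suc (Suc k)"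
  shows "\<exists>v. L n = Fin v \<and> (\<exists>j\<le>N. v = - 1 / X j \<or>
     X j > 1 \<and> (v = 1 - 1 / X j \<or> v = - 1 / (1 - 1 / X j)))"
proof -
  consider "n \<le> k" | "n = Suc k" | "n = Suc (Suc k)" using assms by linarith
  then show ?thesis
  proof cases
    case 1
    then obtain v where "L n = Fin v" "lower_val N n v" using sd(7) by blast
    then show ?thesis unfolding lower_val_def by (blast intro: less_imp_le)
  qed (use bs gt1 in auto)
qed

lemma strong_if_separated:
  assumes sep: "\<And>j. j < N \<Longrightarrow> separated a N j"
  shows "strong_pair (Suc (Suc m)) (Suc (Suc (Suc k)))"
  unfolding strong_pair_def
proof (intro conjI)
  have neq: "1 - 1 / X j \<noteq> t" if "j \<le> N" "X j > 1" for j
  proof (cases "j = N")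
    case True
    have "(X N - 1) * (X N - 1) \<noteq> 0" using ne1 by simp
    then show ?thesis using True gt1 by (simp add: t_def field_simps)
  next
    case False
    then show ?thesis using sep[of j] that gt1 by (auto simp: separated_def t_def)
  qed
  have "m' = Suc (Suc m) \<and> k' = Suc (Suc (Suc k))"
    if h: "1 \<le> m'" "m' \<le> Suc (Suc m)" "1 \<le> k'" "k' \<le> Suc (Suc (Suc k))" "U m' = L k'" for m' k'
  proof -
    have Lk: "\<exists>v. L k' = Fin v \<and> in_lower_part v" using L_lower_end h by simp
    have "\<not> m' \<le> m" using disjoint_points[OF U_upper Lk] h by blast
    moreover have "m' \<noteq> Suc m"
    proof
      assume "m' = Suc m"
      then have Lt: "L k' = Fin t" using h bs by simp
      then have "k' \<noteq> Suc (Suc (Suc k))" using bs t_bounds a_neg by auto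
      then obtain j where j: "j \<le> N" "t = - 1 / X j \<or> X j > 1 \<and> (t = 1 - 1 / X j \<or> t = - 1 / (1 - 1 / X j))"
        using L_vals[of k'] h Lt by auto
      have "- 1 / X j < 0" using bd_le[OF j(1)] by simp
      moreover have "- 1 / (1 - 1 / X j) < 0" if "X j > 1" using that by simp
      ultimately show False using j neq[of j] t_bounds by auto
    qed
    ultimately have m': "m' = Suc (Suc m)" using h by linarith
    moreover have "k' = Suc (Suc (Suc k))"
    proof (rule ccontr)
      assume "k' \<noteq> Suc (Suc (Suc k))"
      then obtain j where j: "j \<le> N" "- 1 / t = - 1 / X j \<or> X j > 1 \<and> (- 1 / t = 1 - 1 / X j \<or> - 1 / t = - 1 / (1 - 1 / X j))"
        using L_vals[of k'] h m' U_end by auto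
      have 1: "- 1 / t \<noteq> - 1 / X j" using bd_le[OF j(1)] t_bounds by auto
      have 2: "- 1 / t \<noteq> 1 - 1 / X j" if "X j > 1"
      proof -
        have "1 - 1 / X j > 0" "- 1 / t < 0" using t_bounds that by auto
        then show ?thesis by linarith
      qed
      have 3: "- 1 / t \<noteq> - 1 / (1 - 1 / X j)" if "X j > 1"
      proof -
        have "1 - 1 / X j > 0" using that by simp
        then show ?thesis using neq[OF j(1) that] t_bounds by (auto simp: divide_simps)
      qed
      show False using j(2) 1 2 3 by blast
    qed
    ultimately show ?thesis by blast
  qed
  then show "\<forall>m' k'. 1 \<le> m' \<and> m' \<le> Suc (Suc m) \<and> 1 \<le> k' \<and> k' \<le> Suc (Suc (Suc k)) \<and> U m' = L k' \<longrightarrow>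
      m' = Suc (Suc m) \<and> k' = Suc (Suc (Suc k))" by blast
  show "WU (Suc (Suc m)) = WL (Suc (Suc (Suc k)))" by (rule words_agree)
qed auto

end

text \<open>With \<open>y = 1 - 1/X N\<close>, what distinguishes the hole is \<open>y > a\<close>: the next
  generator of the lower orbit is \<open>S\<close> instead of \<open>T\<close>. The upper orbit makes the
  same steps as before.\<close>

locale small_exit = exit_stage +
  assumes lt1: "X N < 1"
begin

definition y :: real where "y = 1 - 1 / X N"

lemma y_bounds: "a < y" "y < 0" "- 1 / a < - 1 / y"
proof -
  have "1 < X N * (1 - a)" using in_hole a_neg by (simp add: field_simps)
  then show y: "a < y" "y < 0" using lt1 bd(2) by (auto simp: y_def field_simps)
  then show "- 1 / a < - 1 / y" by (simp add: divide_simps)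
qed

lemmas ss = small_step[OF sd(3,4) bd(2) lt1 bd(1,3), folded y_def]
lemmas sv = small_values[OF lt1 bd(1)]

lemma L_end: "L (Suc (Suc k)) = Fin (- 1 / y)" "WL (Suc (Suc k)) = S_map \<circ> WL (Suc k)"
  using L_S[OF ss(6)] y_bounds b_nonneg by auto

lemma words_agree: "WU (Suc (Suc (Suc m))) = WL (Suc (Suc k))"
proof -
  have "WL (Suc (Suc k)) = (S_map \<circ> T_map \<circ> S_map) \<circ> WU m"
    by (simp only: ss L_end sd(5) comp_assoc)
  then show ?thesis by (simp only: STS_eq ss)
qed

lemma U_upper_end: "1 \<le> n \<Longrightarrow> n \<le> Suc (Suc (Suc m)) \<Longrightarrow> \<exists>v. U n = Fin v \<and> in_upper_part v"
proof -
  assume "1 \<le> n" "n \<le> Suc (Suc (Suc m))"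
  then consider "1 \<le> n" "n \<le> m" | "n = Suc m" | "n = Suc (Suc m)" | "n = Suc (Suc (Suc m))" by linarith
  then show ?thesis
  proof cases
    case 2
    have "X N - 1 \<noteq> a" using no_hit_a_plus_1[OF run stp, of N] by auto
    then show ?thesis using 2 ss sv lt1 by (auto simp: in_upper_part_def)
  next
    case 3
    then show ?thesis using ss sv neg_inverse_a_gt by (auto simp: in_upper_part_def)
  next
    case 4
    then show ?thesis using ss y_bounds neg_inverse_a_gt by (auto simp: in_upper_part_def)
  qed (use U_upper in blast)
qed

lemma U_vals:
  assumes "1 \<le> n" "n \<le> Suc (Suc m)"
  shows "\<exists>v. U n = Fin v \<and> (\<exists>j\<le>N. v = X j \<or> X j < 1 \<and> (v = X j - 1 \<or> v = - 1 / (X j - 1)))"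
proof -
  consider "n \<le> m" | "n = Suc m" | "n = Suc (Suc m)" using assms by linarith
  then show ?thesis
  proof cases
    case 1
    then obtain v where "U n = Fin v" "upper_val N v" using sd(6) assms by blast
    then show ?thesis unfolding upper_val_def by (blast intro: less_imp_le)
  qed (use ss lt1 in auto)
qed

lemma strong_if_separated:
  assumes sep: "\<And>j. j < N \<Longrightarrow> separated a N j"
  shows "strong_pair (Suc (Suc (Suc m))) (Suc (Suc k))"
  unfolding strong_pair_def
proof (intro conjI)
  have neq: "X j - 1 \<noteq> y" if "j \<le> N" "X j < 1" for j
  proof (cases "j = N")
    case True
    have "(X N - 1) * (X N - 1) \<noteq> 0" using ne1 by simp
    then show ?thesis using True bd by (simp add: y_def field_simps)
  next
    case False
    then show ?thesis using sep[of j] that lt1 by (auto simp: separated_def y_def)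
  qed
  have "m' = Suc (Suc (Suc m)) \<and> k' = Suc (Suc k)"
    if h: "1 \<le> m'" "m' \<le> Suc (Suc (Suc m))" "1 \<le> k'" "k' \<le> Suc (Suc k)" "U m' = L k'" for m' k'
  proof -
    have Um: "\<exists>v. U m' = Fin v \<and> in_upper_part v" using U_upper_end[OF h(1,2)] .
    have "\<not> k' \<le> k" using disjoint_points[OF Um L_lower] h by blast
    moreover have "k' \<noteq> Suc k"
    proof
      assume "k' = Suc k"
      then have Uy: "U m' = Fin y" using h ss by simp
      have "- 1 / y > 0" using y_bounds by simp
      then have "- 1 / y \<noteq> y" using y_bounds by linarith
      then have "m' \<noteq> Suc (Suc (Suc m))" using ss(3) Uy by auto
      then obtain j where j: "j \<le> N" "y = X j \<or> X j < 1 \<and> (y = X j - 1 \<or> y = - 1 / (X j - 1))"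
        using U_vals[of m'] h Uy by auto
      have "- 1 / (X j - 1) > 0" if "X j < 1" using that by simp
      then show False using j neq[of j] y_bounds bd_le[OF j(1)] by auto
    qed
    ultimately have k': "k' = Suc (Suc k)" using h by linarith
    moreover have "m' = Suc (Suc (Suc m))"
    proof (rule ccontr)
      assume "m' \<noteq> Suc (Suc (Suc m))"
      then obtain j where j: "j \<le> N" "- 1 / y = X j \<or> X j < 1 \<and> (- 1 / y = X j - 1 \<or> - 1 / y = - 1 / (X j - 1))"
        using U_vals[of m'] h k' L_end by auto
      have 1: "- 1 / y \<noteq> X j" using bd_le[OF j(1)] y_bounds by auto
      have 2: "- 1 / y \<noteq> X j - 1" if "X j < 1"
      proof -
        have "- 1 / y > 0" using y_bounds by simp
        then show ?thesis using that by linarith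
      qed
      have 3: "- 1 / y \<noteq> - 1 / (X j - 1)" if "X j < 1"
        using neq[OF j(1) that] y_bounds that by (auto simp: divide_simps)
      show False using j(2) 1 2 3 by blast
    qed
    ultimately show ?thesis by blast
  qed
  then show "\<forall>m' k'. 1 \<le> m' \<and> m' \<le> Suc (Suc (Suc m)) \<and> 1 \<le> k' \<and> k' \<le> Suc (Suc k) \<and> U m' = L k' \<longrightarrow>
      m' = Suc (Suc (Suc m)) \<and> k' = Suc (Suc k)" by blast
  show "WU (Suc (Suc (Suc m))) = WL (Suc (Suc k))" by (rule words_agree)
qed auto

end

section \<open>Parameters without the strong cycle property\<close>

context cf_params
begin

lemma expanding_upper_val:
  assumes "running i" "- 1 < a" "upper_val i v"
  shows "expanding_step (upper_branch a b) (Fin v)"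
proof (cases "v < b")
  case True
  then have "a \<le> v" "v < 0" using upper_val_cases[OF assms(1,3)] by auto
  then show ?thesis using True upper_branch_S assms(2) by (auto simp: expanding_step_def)
qed (use upper_branch_Tinv in \<open>auto simp: expanding_step_def\<close>)

lemma expanding_lower_part:
  assumes "- 1 < a" "in_lower_part v"
  shows "expanding_step (lower_branch a b) (Fin v)"
proof (cases "v \<le> a")
  case False
  then have "0 < v" "v \<le> a + 1" using assms(2) by (auto simp: in_lower_part_def)
  then show ?thesis using lower_branch_S[of v] gap a_neg by (auto simp: expanding_step_def)
qed (use lower_branch_T in \<open>auto simp: expanding_step_def\<close>)

text \<open>If \<open>a\<close> and \<open>b\<close> are both less than \<open>1\<close> in absolute value,
  then every \<open>S\<close> is expanding, on whatever part of the line the orbit is.\<close>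

lemma expanding_if_short:
  assumes "- 1 < a" "b < 1" "z \<noteq> 0"
  shows "expanding_step (upper_branch a b) (Fin z)" "expanding_step (lower_branch a b) (Fin z)"
  using assms a_less_b
  by (auto simp: expanding_step_def upper_branch_def lower_branch_def f_branch_def)

lemma upper_branch_at_a: "upper_branch a b (Fin a) = S_map"
  and lower_branch_at_a: "lower_branch a b (Fin a) = T_map"
  using upper_branch_S lower_branch_T a_less_b by auto

lemma L_1: "L 1 = Fin (a + 1)" "WL 1 = T_map"
  using lower_branch_at_a by (simp_all add: orbit_pt_simps orbit_word_Suc generators_at_point)

lemma strong_pairD:
  assumes "strong_pair m k"
  shows "1 \<le> m" "1 \<le> k" "WU m = WL k" "U m = L k"
    "\<And>m' k'. 1 \<le> m' \<Longrightarrow> m' \<le> m \<Longrightarrow> 1 \<le> k' \<Longrightarrow> k' \<le> k \<Longrightarrow> U m' = L k' \<Longrightarrow> m' = m \<and> k' = k"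
  using assms orbit_word_eq_imp_pt_eq unfolding strong_pair_def by blast+

text \<open>The disjointness of the two sets leaves only a meeting at \<open>a\<close> or \<open>a +
  1\<close>. The upper orbit can reach \<open>a\<close> only from \<open>a + 1\<close>, and \<open>a + 1 = T
  a\<close> is where the lower orbit is at time \<open>1\<close>, so the first meeting has lower word
  \<open>T\<close>, of slope \<open>1\<close>. The upper word begins with an expanding
  \<open>S\<close>.\<close>

lemma not_strong_if_never_stop:
  assumes never: "\<And>i. \<not> stop (X i)"
  shows "\<not> strong_pair m k"
proof
  assume "strong_pair m k"
  note sp = strong_pairD[OF this]
  have run: "running i" for i using never by (simp add: running_def)
  have a1: "- 1 < a" using first_not_stop never by blast
  have Lv: "\<exists>v. L n = Fin v \<and> in_lower_part v" for n
  proof -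
    obtain m' k' where "stage n m' k'" using stage_exists run by blast
    then show ?thesis using stageD(2)[of n m' k'] stageD(7)[of n m' k' n] lower_val_in_lower_part[OF run] by blast
  qed
  have Uv: "\<exists>v i. U n = Fin v \<and> upper_val i v" if "1 \<le> n" for n
  proof -
    obtain m' k' where "stage n m' k'" using stage_exists run by blast
    then show ?thesis using stageD(1,6)[of n m' k'] that less_imp_le by blast
  qed
  obtain v i where v: "U m = Fin v" "upper_val i v" using Uv sp(1) by blast
  have "in_lower_part v" using Lv[of k] sp(4) v by auto
  then have "v = a \<or> v = a + 1"
    using upper_val_cases(4)[OF run v(2)] parts_disjoint by blast
  then have "U m = Fin (a + 1)"
  proof
    assume va: "v = a"
    obtain p where p: "m = Suc p" using sp(1) by (cases m) auto
    have "p \<noteq> 0"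
    proof
      assume "p = 0"
      then have "- 1 / a = a"
        using v(1) va p upper_branch_at_a a_neg by (simp add: orbit_pt_simps generators_at_point)
      moreover have "- 1 / a > 0" using a_neg by simp
      ultimately show False using a_neg by linarith
    qed
    then obtain w i' where w: "U p = Fin w" "upper_val i' w" using Uv[of p] by auto
    note wc = upper_val_cases[OF run w(2)]
    have "b \<le> w"
    proof (rule ccontr)
      assume "\<not> b \<le> w"
      then have "U (Suc p) = Fin (- 1 / w)" "w < 0" using U_S[OF w(1)] wc by auto
      then have "- 1 / w = a" "- 1 / w > 0" using v(1) va p by auto
      then show False using a_neg by simp
    qed
    then have "w - 1 = a" using U_Tinv[OF w(1)] v(1) va p by simp
    then have "U p = L 1" using w(1) L_1 by simp
    then show ?thesis using sp(5)[of p 1] p \<open>p \<noteq> 0\<close> sp(2) by simp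
  qed (use v in simp)
  then have "k = 1" using sp(5)[of m 1] sp(1,2) L_1 by simp
  have "slope (upper_branch a b) a m = slope (lower_branch a b) a 1"
  proof (rule slope_eq_if_word_eq)
    show "WU m = WL 1" using sp(3) \<open>k = 1\<close> by simp
    fix j show "expanding_step (upper_branch a b) (U j)"
    proof (cases "j = 0")
      case True
      then show ?thesis using expanding_step_def upper_branch_at_a a1 a_neg
        by (auto simp: orbit_pt_simps)
    next
      case False
      then obtain w i' where "U j = Fin w" "upper_val i' w" using Uv[of j] by auto
      then show ?thesis using expanding_upper_val[OF run a1] by simp
    qed
    show "expanding_step (lower_branch a b) (L j)"
      using Lv[of j] expanding_lower_part[OF a1] by auto
  qed
  moreover have "slope (upper_branch a b) a 0 < slope (upper_branch a b) a m"
  proof (rule slope_strict_mono[of m _ _ 0 0])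
    fix j show "expanding_step (upper_branch a b) (U j)"
    proof (cases "j = 0")
      case True
      then show ?thesis using expanding_step_def upper_branch_at_a a1 a_neg
        by (auto simp: orbit_pt_simps)
    next
      case False
      then obtain w i' where "U j = Fin w" "upper_val i' w" using Uv[of j] by auto
      then show ?thesis using expanding_upper_val[OF run a1] by simp
    qed
  qed (use sp(1) upper_branch_at_a in \<open>auto simp: orbit_pt_simps\<close>)
  ultimately show False
    using lower_branch_at_a generators_distinct by (simp add: slope_def orbit_pt_simps)
qed

text \<open>The orbits meet at \<open>0\<close> and, if \<open>b > 0\<close>, both continue to infinity and
  stay there. For \<open>b = 0\<close> the lower orbit has no earlier points at all. So there is no other
  candidate for a first meeting, and the words at \<open>0\<close> are different.\<close>

lemma not_strong_if_hits_1:
  assumes run: "running N" and XN: "X N = 1"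
  shows "\<not> strong_pair m' k'"
proof
  assume "strong_pair m' k'"
  note sp = strong_pairD[OF this]
  have stp: "stop (X N)" using XN by (simp add: stop_def)
  obtain m k where st: "stage N m k" using stage_exists run by blast
  note sd = stageD[OF st]
  have bd: "b \<le> 1" "- 1 \<le> a" using running_bounds[OF run] XN a_neg by (auto simp: field_simps)
  have U1: "U (Suc m) = Fin 0" "WU (Suc m) = Tinv_map \<circ> WU m"
    using U_Tinv[of m 1] sd(3) XN bd by auto
  have L1: "L (Suc k) = Fin 0" "WL (Suc k) = T_map \<circ> WL k"
    using L_T[of k "-1"] sd(4) XN bd by auto
  have "lower_branch a b (Fin 0) = S_map" using lower_branch_S a_neg b_nonneg by simp
  then have "L (Suc (Suc k)) = Infty"
    using L1 by (simp add: orbit_pt_simps generators_at_point)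
  then have Linf: "L n = Infty" if "Suc (Suc k) \<le> n" for n
    using orbit_stays_at_Infty branch_Infty that by blast
  have Uin: "\<exists>v. U n = Fin v \<and> in_upper_part v" if "1 \<le> n" "n \<le> m" for n
    using sd(6)[OF that] upper_val_in_upper_part[OF run] no_hit_a_plus_1[OF run stp] by blast
  have Lin: "\<exists>v. L n = Fin v \<and> in_lower_part v" if "n \<le> k" for n
    using sd(7)[OF that] lower_val_in_lower_part[OF run] by blast
  consider "m' \<le> m" | "Suc m \<le> m'" "k' \<le> k" | "Suc m \<le> m'" "Suc k \<le> k'" by linarith
  then show False
  proof cases
    case 1
    obtain v where v: "U m' = Fin v" "in_upper_part v" using Uin sp(1) 1 by blast
    consider "k' \<le> k" | "k' = Suc k" | "Suc (Suc k) \<le> k'" by linarith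
    then show False
    proof cases
      case 1 then show False using Lin[of k'] v sp(4) parts_disjoint by auto
    next
      case 2 then show False using L1 v sp(4) bd by (auto simp: in_upper_part_def)
    next
      case 3 then show False using Linf v sp(4) by auto
    qed
  next
    case 2
    then have "k \<noteq> 0" using sp(2) by simp
    have "N \<noteq> 0"
    proof
      assume "N = 0" then show False using stage_0_k st \<open>k \<noteq> 0\<close> by blast
    qed
    then have "\<not> stop (X 0)" using run by (simp add: running_def)
    then have b0: "0 < b" and a1: "- 1 < a" by (auto dest: first_not_stop)
    have "upper_branch a b (Fin 0) = S_map" using upper_branch_S a_neg b0 by simp
    then have "U (Suc (Suc m)) = Infty"
      using U1 by (simp add: orbit_pt_simps generators_at_point)
    then have "U m' = Fin 0 \<or> U m' = Infty"
      using orbit_stays_at_Infty branch_Infty 2(1) U1(1) by (metis Suc_leI le_neq_implies_less)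
    then show False using Lin[OF 2(2)] sp(4) a_neg by (auto simp: in_lower_part_def)
  next
    case 3
    then have "m' = Suc m" "k' = Suc k" using sp(5)[of "Suc m" "Suc k"] U1(1) L1(1) by auto
    then have "WU (Suc m) = WL (Suc k)" using sp(3) by simp
    then have "Tinv_map \<circ> WU m = (T_map \<circ> S_map) \<circ> WU m"
      by (simp only: U1 L1 sd(5) comp_assoc)
    moreover have "bij (WU m)" by (rule bij_orbit_word) (rule branch_cases)
    then have "surj (WU m)" by (rule bij_is_surj)
    ultimately have "Tinv_map = T_map \<circ> S_map"
      by (metis comp_apply ext surjD)
    then show False using generators_distinct by blast
  qed
qed

end

context exit_stage
begin

lemma N_pos_bounds:
  assumes "0 < N" shows "- 1 < a" "0 < b" "1 \<le> N"
proof -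
  have "\<not> stop (X 0)" using run assms by (simp add: running_def)
  then show "- 1 < a" "0 < b" by (auto dest: first_not_stop)
  show "1 \<le> N" using assms by simp
qed

text \<open>Outside the hole, a coincidence is an equality case of the inequalities \<open>1 - 1/X j \<le> a
  + 1 \<le> b \<le> X i - 1\<close> or \<open>1 - 1/X i \<le> a \<le> b - 1 \<le> X j - 1\<close>, which
  forces the sequence to hit \<open>a + 1\<close>.\<close>

lemma separated_before:
  assumes "j < i" "i < N"
  shows "separated a i j"
proof -
  have bj: "b \<le> X j" "0 < X j" "X j \<le> - 1 / a" and bi: "0 < X i" using bd_le[of j] bd_le[of i] assms by auto
  have ns: "\<not> stop (X i)" using run assms by (simp add: running_def)
  have "X i - 1 \<noteq> 1 - 1 / X j" if "X i > 1" "X j > 1"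
  proof
    assume eq: "X i - 1 = 1 - 1 / X j"
    have "X i \<ge> 1 + b" using ns that by (cases rule: not_stop_cases) auto
    moreover have "1 - 1 / X j \<le> a + 1" using big_values that bj by blast
    ultimately have "X i - 1 = a + 1" using eq gap by linarith
    then have "X (Suc i) = a + 1" using that by (simp add: farey_orbit_simps farey_def)
    then show False using no_hit_a_plus_1[OF run stp, of "Suc i"] assms by simp
  qed
  moreover have "1 - 1 / X i \<noteq> X j - 1" if "X i < 1" "X j < 1"
  proof
    assume eq: "1 - 1 / X i = X j - 1"
    have "X i \<le> 1 / (1 - a)" using ns that by (cases rule: not_stop_cases) auto
    then have "1 - 1 / X i \<le> a" using small_bound(3) bi by fastforce
    then have "X j = a + 1" using eq gap bj by linarith
    then show False using no_hit_a_plus_1[OF run stp, of j] assms by simp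
  qed
  ultimately show ?thesis by (simp add: separated_def)
qed

end

context big_exit
begin

text \<open>The upper orbit reaches \<open>t\<close> one step before the meeting point \<open>-1/t\<close>,
  and by coincidence the lower orbit has passed through \<open>t\<close>, hence through \<open>-1/t\<close>,
  before. So the lower orbit is periodic, it remains in the lower set forever, and no two of its words on
  either side of the step \<open>Suc k\<close> are equal. After the meeting the upper orbit follows the
  lower one, since the latter avoids \<open>a\<close> and \<open>b\<close>. A strong pair must have its
  upper time after \<open>m\<close>, where the upper orbit leaves its own set, and would then produce two
  equal words of the lower orbit.\<close>

lemma not_strong_if_not_separated:
  assumes j: "j < N" "X j > 1" and coinc: "t = 1 - 1 / X j"
  shows "\<not> strong_pair m' k'"
proof
  assume "strong_pair m' k'"
  note sp = strong_pairD[OF this]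
  have a1: "- 1 < a" and b0: "0 < b" and N1: "1 \<le> N" using N_pos_bounds j by auto
  define K where "K = Suc (Suc (Suc k))"
  obtain n0 where n0: "1 \<le> n0" "n0 \<le> k" "L n0 = Fin t" using sd(9) j coinc by auto
  have at_t: "L (Suc n) = Fin (- 1 / t)" "WL (Suc n) = S_map \<circ> WL n" if "L n = Fin t" for n
    using L_S[OF that] t_bounds a_neg by auto
  define d where "d = K - Suc n0"
  have d: "Suc n0 + d = K" "0 < d" using n0 by (auto simp: d_def K_def)
  have "L K = L (Suc n0)" using at_t[OF n0(3)] bs K_def by simp
  then have per: "L (Suc n0 + d) = L (Suc n0)" using d by simp
  have range: "\<exists>n'. Suc n0 \<le> n' \<and> n' < K \<and> L n = L n'" if "Suc n0 \<le> n" for n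
    using orbit_pt_periodic_range[OF per d(2) that] d by simp
  have Lall: "\<exists>v. L n = Fin v \<and> in_lower_part v" for n
  proof (cases "n \<le> k")
    case False
    then obtain n' where "n' < K" "L n = L n'" using range[of n] n0 by auto
    then show ?thesis using L_lower_end[of n'] K_def by simp
  qed (use L_lower in blast)
  have ex: "expanding_step (lower_branch a b) (L n)" for n
    using Lall[of n] expanding_lower_part[OF a1] by auto
  have S_step: "lower_branch a b (L (Suc k)) = S_map"
    using bs lower_branch_S bv a_neg gap by simp
  \<comment> \<open>The step at time \<open>Suc k\<close> applies \<open>S\<close> and lies strictly between any two such times.\<close>
  have no_loop: "WL n \<noteq> WL n'" if "n \<le> Suc k" "K \<le> n'" for n n'
  proof
    assume "WL n = WL n'"
    then have "slope (lower_branch a b) a n = slope (lower_branch a b) a n'"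
      by (rule slope_eq_if_word_eq) (rule ex)+
    moreover have "slope (lower_branch a b) a n < slope (lower_branch a b) a n'"
      by (rule slope_strict_mono[OF ex that(1) _ S_step]) (use that K_def in auto)
    ultimately show False by simp
  qed
  have off_ends: "L n \<noteq> Fin a" "L n \<noteq> Fin b" if n: "Suc n0 \<le> n" for n
  proof -
    obtain n' where n': "Suc n0 \<le> n'" "n' < K" "L n = L n'" using range[OF n] by blast
    \<comment> \<open>The values \<open>a\<close> and \<open>a + 1\<close> can only come from \<open>X 0\<close>, that is from times \<open>0\<close> and \<open>1\<close>.\<close>
    have ne0: "i = 0" if "i \<le> N" "X i = X 0" for i
      using no_return_to_start[OF run stp, of i] that by (cases i) auto
    have X0: "X 0 = - 1 / a" by (simp add: farey_orbit_simps)
    have first_type: "x = - 1 / a" if "1 - 1 / x = b" "1 < x" "x \<le> - 1 / a" for x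
    proof -
      have "1 - 1 / x = a + 1" using big_values(2)[OF that(2,3)] that gap by linarith
      then have "a * x = - 1" using that(2) by (simp add: field_simps)
      then show ?thesis using a_neg by (simp add: field_simps)
    qed
    have "\<exists>v. L n' = Fin v \<and> v \<noteq> a \<and> v \<noteq> b"
    proof (cases "n' \<le> k")
      case True
      then obtain v where v: "L n' = Fin v" "lower_val N n' v" using sd(7) by blast
      have "v \<noteq> a \<and> v \<noteq> b"
        using v(2) unfolding lower_val_def
      proof (elim disjE exE conjE)
        fix i assume i: "i \<le> N" "v = - 1 / X i" "i = 0 \<longrightarrow> n' = 0"
        have Xi: "0 < X i" using bd_le[OF i(1)] by simp
        have "v \<noteq> a"
        proof
          assume "v = a"
          then have "a * X i = a * X 0" using i(2) Xi X0 a_neg by (simp add: field_simps)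
          then have "X i = X 0" using a_neg by simp
          then show False using ne0 i n' by simp
        qed
        moreover have "v < 0" using i Xi by simp
        ultimately show ?thesis using b0 by simp
      next
        fix i assume i: "i < N" "X i > 1" "v = 1 - 1 / X i" "i = 0 \<longrightarrow> n' = 1"
        have "X i \<le> - 1 / a" using bd_le[of i] i by simp
        then have "v \<noteq> b" using first_type[of "X i"] ne0[of i] X0 i n' n0 by auto
        moreover have "v > 0" using i by simp
        ultimately show ?thesis using a_neg by simp
      next
        fix i assume i: "i < N" "X i > 1" "v = - 1 / (1 - 1 / X i)"
        have "v < a" using big_values(3)[OF i(2)] bd_le[of i] i by simp
        then show ?thesis using a_less_b by simp
      qed
      then show ?thesis using v by blast
    next
      case False
      then consider "n' = Suc k" | "n' = Suc (Suc k)" using n' K_def by linarith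
      then show ?thesis
      proof cases
        case 1
        have "1 - 1 / X N \<noteq> b" using first_type[of "X N"] gt1 bd ne0[of N] X0 N1 by auto
        then show ?thesis using 1 bs bv a_neg by auto
      next
        case 2
        then show ?thesis using bs bv a_less_b by auto
      qed
    qed
    then show "L n \<noteq> Fin a" "L n \<noteq> Fin b" using n' by auto
  qed
  have follow: "U (Suc (Suc m) + i) = L (K + i) \<and> WU (Suc (Suc m) + i) = WL (K + i)" for i
  proof (induction i)
    case 0 show ?case using words_agree U_end bs K_def by simp
  next
    case (Suc i)
    have "upper_branch a b (L (K + i)) = lower_branch a b (L (K + i))"
      using off_ends[of "K + i"] d by (simp add: upper_branch_def lower_branch_def)
    moreover have "U (Suc (Suc m) + i) = L (K + i)" "WU (Suc (Suc m) + i) = WL (K + i)"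
      using Suc by blast+
    ultimately show ?case by (simp only: add_Suc_right orbit_pt_simps orbit_word_Suc)
  qed
  have first: "m' = Suc m \<and> k' = n0 \<or> k' < n0 \<or> m' \<le> m"
    using sp(5)[of "Suc m" n0] n0 bs(1) by auto
  have "\<not> m' \<le> m" using disjoint_points[OF U_upper[OF sp(1)] Lall[of k']] sp(4) by blast
  with first have "k' \<le> n0" "Suc m \<le> m'" by auto
  show False
  proof (cases "m' = Suc m")
    case True
    then have "L k' = Fin t" using sp(4) bs(1) by simp
    then have "WL (Suc k') = WU (Suc m')" using at_t U_end sp(3) True by simp
    then have "WL (Suc k') = WL K" using words_agree True K_def by simp
    then show False using no_loop[of "Suc k'" K] \<open>k' \<le> n0\<close> n0 by simp
  next
    case False
    then obtain i where "m' = Suc (Suc m) + i" using \<open>Suc m \<le> m'\<close> by (metis Suc_leI le_neq_implies_less le_iff_add)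
    then have "WL k' = WL (K + i)" using sp(3) follow[of i] by simp
    then show False using no_loop[of k' "K + i"] \<open>k' \<le> n0\<close> n0 by simp
  qed
qed

end

context small_exit
begin

text \<open>Here the upper orbit is the periodic one. Unlike in the previous case it may pass through
  \<open>b\<close>, where the lower orbit ceases to follow it. But now \<open>b \<le> X N < 1\<close>, so
  all applications of \<open>S\<close> are expanding, and the slopes of the lower words cannot decrease
  whatever the lower orbit does.\<close>

lemma not_strong_if_not_separated:
  assumes j: "j < N" "X j < 1" and coinc: "y = X j - 1"
  shows "\<not> strong_pair m' k'"
proof
  assume "strong_pair m' k'"
  note sp = strong_pairD[OF this]
  have a1: "- 1 < a" and b0: "0 < b" using N_pos_bounds j by auto
  have b1: "b < 1" using bd lt1 by simp
  define M where "M = Suc (Suc (Suc m))"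
  obtain m0 where m0: "1 \<le> m0" "m0 \<le> m" "U m0 = Fin y" using sd(8) j coinc by auto
  have at_y: "U (Suc n) = Fin (- 1 / y)" "WU (Suc n) = S_map \<circ> WU n" if "U n = Fin y" for n
    using U_S[OF that] y_bounds b0 by auto
  define d where "d = M - Suc m0"
  have d: "Suc m0 + d = M" "0 < d" using m0 by (auto simp: d_def M_def)
  have "U M = U (Suc m0)" using at_y[OF m0(3)] ss M_def by simp
  then have per: "U (Suc m0 + d) = U (Suc m0)" using d by simp
  have Uall: "\<exists>v. U n = Fin v \<and> in_upper_part v" if "1 \<le> n" for n
  proof (cases "n \<le> m")
    case False
    then obtain n' where "Suc m0 \<le> n'" "n' < M" "U n = U n'"
      using orbit_pt_periodic_range[OF per d(2), of n] d m0 by auto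
    then show ?thesis using U_upper_end[of n'] M_def by simp
  qed (use U_upper that in blast)
  have Uex: "expanding_step (upper_branch a b) (U n)" for n
  proof (cases "n = 0")
    case True then show ?thesis using expanding_if_short(1)[OF a1 b1] a_neg by (simp add: orbit_pt_simps)
  next
    case False
    then obtain v where "U n = Fin v" "in_upper_part v" using Uall[of n] by auto
    moreover have "v \<noteq> 0" using \<open>in_upper_part v\<close> a1 by (auto simp: in_upper_part_def)
    ultimately show ?thesis using expanding_if_short(1)[OF a1 b1] by simp
  qed
  have S_step: "upper_branch a b (U (Suc m)) = S_map"
    using ss upper_branch_S sv lt1 b0 by simp
  have U_grow: "slope (upper_branch a b) a n < slope (upper_branch a b) a M" if "n \<le> Suc m" for n
    by (rule slope_strict_mono[OF Uex that _ S_step]) (simp add: M_def)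
  have "\<not> k' \<le> k" using disjoint_points[OF Uall[OF sp(1)] L_lower] sp(4) by blast
  then consider "k' = Suc k" | "Suc (Suc k) \<le> k'" by linarith
  then show False
  proof cases
    case 1
    then have "m' \<le> m0" using sp(5)[of m0 "Suc k"] m0 ss by (cases "m0 \<le> m'") auto
    have "U m' = Fin y" using 1 sp(4) ss by simp
    then have "WU (Suc m') = WU M" using at_y sp(3) 1 L_end words_agree M_def by simp
    then have "slope (upper_branch a b) a (Suc m') = slope (upper_branch a b) a M"
      by (rule slope_eq_if_word_eq) (rule Uex)+
    then show False using U_grow[of "Suc m'"] \<open>m' \<le> m0\<close> m0 by simp
  next
    case 2
    then have "m' < m0" using sp(5)[of m0 "Suc k"] m0 ss by (cases "m0 \<le> m'") auto
    \<comment> \<open>The lower orbit cannot have passed through \<open>0\<close>: from there it would have gone to infinity for good.\<close>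
    have Lex: "expanding_step (lower_branch a b) (L n)" if n: "n < k'" for n
    proof -
      have fin: "L i \<noteq> Infty" if "i \<le> k'" for i
        using orbit_stays_at_Infty[where g = "lower_branch a b", OF branch_Infty(2) _ that] Uall[OF sp(1)] sp(4) by force
      obtain z where z: "L n = Fin z" using fin[of n] n by (cases "L n") auto
      have "z \<noteq> 0"
      proof
        assume "z = 0"
        then have "L (Suc n) = Infty"
          using z lower_branch_S[of 0] a_neg b0 by (simp add: orbit_pt_simps generators_at_point)
        then show False using fin[of "Suc n"] n by simp
      qed
      then show ?thesis using z expanding_if_short(2)[OF a1 b1] by simp
    qed
    have "slope (upper_branch a b) a M = slope (lower_branch a b) a (Suc (Suc k))"
      using slope_eq_if_word_eq[of "upper_branch a b" a M "lower_branch a b" "Suc (Suc k)"]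
        words_agree M_def Uex Lex 2 by simp
    also have "\<dots> \<le> slope (lower_branch a b) a k'"
      using slope_mono[of k' "lower_branch a b" a "Suc (Suc k)"] Lex 2 by blast
    also have "\<dots> = slope (upper_branch a b) a m'"
      using slope_eq_if_word_eq[of "upper_branch a b" a m' "lower_branch a b" k'] sp(3) Uex Lex by simp
    finally show False using U_grow[of m'] \<open>m' < m0\<close> m0 by simp
  qed
qed

end

section \<open>Characterisation of the strong cycle property\<close>

context cf_params
begin

text \<open>Everything is decided at the first time \<open>N\<close> at which the sequence stops, if there
  is one.\<close>

theorem strong_cycle_a_iff_clean_exit: "strong_cycle_a a b \<longleftrightarrow> clean_exit a b"
proof (cases "\<exists>i. stop (X i)")
  case False
  then have "\<not> strong_cycle_a a b"
    using not_strong_if_never_stop by (auto simp: strong_cycle_a_iff_pair)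
  moreover have "\<not> clean_exit a b" using False by (auto simp: clean_exit_def stop_def)
  ultimately show ?thesis by blast
next
  case True
  define N where "N = (LEAST i. stop (X i))"
  have stp: "stop (X N)" using LeastI_ex[OF True] by (simp add: N_def)
  have run: "running N" using not_less_Least by (auto simp: N_def running_def)
  obtain m k where st: "stage N m k" using stage_exists run by blast
  have N_le: "N \<le> n" if "stop (X n)" for n using that by (simp add: N_def Least_le)
  show ?thesis
  proof (cases "X N = 1")
    case True
    have "X (N + n) = 1" for n by (induction n) (simp_all add: True farey_orbit_simps farey_def)
    then have "X n = 1" if "stop (X n)" for n using N_le[OF that] by (metis le_iff_add)
    then have "\<not> clean_exit a b" by (auto simp: clean_exit_def stop_def)
    moreover have "\<not> strong_cycle_a a b"
      using not_strong_if_hits_1[OF run True] by (auto simp: strong_cycle_a_iff_pair)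
    ultimately show ?thesis by blast
  next
    case False
    interpret exit_stage a b N m k by unfold_locales (use run stp st False in auto)
    have clean: "clean_exit a b \<longleftrightarrow> (\<forall>j<N. separated a N j)"
    proof
      assume "clean_exit a b"
      then obtain n where "stop (X n)" "\<forall>i\<le>n. \<forall>j<i. separated a i j"
        unfolding clean_exit_def stop_def by blast
      then show "\<forall>j<N. separated a N j" using N_le[of n] by blast
    next
      assume "\<forall>j<N. separated a N j"
      then have "\<forall>i\<le>N. \<forall>j<i. separated a i j"
        using separated_before by (metis le_neq_implies_less)
      then show "clean_exit a b" using in_hole False unfolding clean_exit_def by blast
    qed
    consider "X N > 1" | "X N < 1" using False by linarith
    then show ?thesis
    proof cases
      case 1
      interpret big_exit a b N m k by unfold_locales (rule 1)
      have "separated a N j" if "strong_pair m' k'" "j < N" for m' k' j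
        using not_strong_if_not_separated[OF that(2)] that(1) 1 by (auto simp: separated_def t_def)
      then show ?thesis using strong_if_separated by (auto simp: clean strong_cycle_a_iff_pair)
    next
      case 2
      interpret small_exit a b N m k by unfold_locales (rule 2)
      have "separated a N j" if "strong_pair m' k'" "j < N" for m' k' j
        using not_strong_if_not_separated[OF that(2)] that(1) 2 by (auto simp: separated_def y_def)
      then show ?thesis using strong_if_separated by (auto simp: clean strong_cycle_a_iff_pair)
    qed
  qed
qed

end

text \<open>The upper orbit consists of infinity only, and the lower one of \<open>1\<close>,
  \<open>-1\<close> and \<open>0\<close>.\<close>

lemma not_strong_cycle_a_zero:
  assumes "1 \<le> b"
  shows "\<not> strong_cycle_a 0 b"
proof
  assume "strong_cycle_a 0 b"
  then obtain m k where eq: "orbit_pt (upper_branch 0 b) (S_map (Fin 0)) m = orbit_pt (lower_branch 0 b) (T_map (Fin 0)) k"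
    unfolding strong_cycle_a_def first_common_def by blast
  have "orbit_pt (upper_branch 0 b) (S_map (Fin 0)) m = Infty"
    by (induction m) (simp_all add: orbit_pt_simps generators_at_point branch_Infty)
  moreover have "orbit_pt (lower_branch 0 b) (T_map (Fin 0)) k \<in> {Fin 1, Fin (- 1), Fin 0}"
    using assms
    by (induction k) (auto simp: orbit_pt_simps generators_at_point lower_branch_def f_branch_def)
  ultimately show False using eq by auto
qed

section \<open>The clean exit condition is open\<close>

lemma farey_pos: "0 < x \<Longrightarrow> 0 < farey x"
  by (simp add: farey_def)

lemma farey_orbit_pos: "a < 0 \<Longrightarrow> 0 < farey_orbit a i"
  by (induction i) (simp_all add: farey_orbit_simps farey_pos)

lemma farey_orbit_ne_1:
  assumes "farey_orbit a n \<noteq> 1" "i \<le> n"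
  shows "farey_orbit a i \<noteq> 1"
proof
  assume "farey_orbit a i = 1"
  with assms(2) have "farey_orbit a n = 1"
    by (induction n rule: dec_induct) (simp_all add: farey_orbit_simps farey_def)
  with assms(1) show False ..
qed

lemma isCont_farey:
  assumes "x \<noteq> 1" "0 < x"
  shows "isCont farey x"
proof (cases "x > 1")
  case True
  have "\<forall>\<^sub>F y in nhds x. farey y = y - 1"
    using eventually_nhds_in_open[of "{1<..}" x] True
    by (auto simp: farey_def elim: eventually_mono)
  then have "isCont farey x \<longleftrightarrow> isCont (\<lambda>y. y - 1) x" by (rule isCont_cong)
  then show ?thesis by simp
next
  case False
  have "\<forall>\<^sub>F y in nhds x. farey y = y / (1 - y)"
    using eventually_nhds_in_open[of "{..<1}" x] False assms
    by (auto simp: farey_def elim: eventually_mono)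
  then have "isCont farey x \<longleftrightarrow> isCont (\<lambda>y. y / (1 - y)) x" by (rule isCont_cong)
  then show ?thesis using assms by simp
qed

text \<open>On the positive numbers the Farey map is discontinuous only at \<open>1\<close>.\<close>

lemma isCont_farey_orbit:
  assumes "a < 0" "\<And>j. j < i \<Longrightarrow> farey_orbit a j \<noteq> 1"
  shows "isCont (\<lambda>c. farey_orbit c i) a"
  using assms(2)
proof (induction i)
  case 0
  then show ?case using assms(1) by (simp add: farey_orbit_simps)
next
  case (Suc i)
  then have "isCont (\<lambda>c. farey_orbit c i) a" by simp
  moreover have "isCont farey (farey_orbit a i)"
    using isCont_farey farey_orbit_pos[OF assms(1)] Suc.prems[of i] by simp
  ultimately show ?case unfolding farey_orbit_simps by (rule isCont_o2)
qed

text \<open>Neither \<open>X i\<close> nor \<open>X j\<close> changes its position relative to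
  \<open>1\<close> under small perturbations, so that the same clause of separation, if any, remains the
  relevant one.\<close>

lemma eventually_separated:
  assumes lim: "((\<lambda>c. farey_orbit c i) \<longlongrightarrow> farey_orbit a i) (nhds a)"
      "((\<lambda>c. farey_orbit c j) \<longlongrightarrow> farey_orbit a j) (nhds a)"
    and "a < 0" "farey_orbit a i \<noteq> 1" "farey_orbit a j \<noteq> 1" "separated a i j"
  shows "\<forall>\<^sub>F c in nhds a. separated c i j"
proof -
  let ?x = "\<lambda>c. farey_orbit c i" and ?y = "\<lambda>c. farey_orbit c j"
  have pos: "?x a \<noteq> 0" "?y a \<noteq> 0" using farey_orbit_pos[OF assms(3)] by (auto simp: less_le)
  have side: "\<forall>\<^sub>F c in nhds a. (f c > 1 \<longleftrightarrow> f a > 1) \<and> (f c < 1 \<longleftrightarrow> f a < 1)"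
    if "(f \<longlongrightarrow> f a) (nhds a)" "f a \<noteq> 1" for f :: "real \<Rightarrow> real"
  proof (cases "f a > 1")
    case True
    show ?thesis using order_tendstoD(1)[OF that(1) True] by eventually_elim (use True in auto)
  next
    case False
    then have "f a < 1" using that by simp
    show ?thesis using order_tendstoD(2)[OF that(1) \<open>f a < 1\<close>] by eventually_elim (use \<open>f a < 1\<close> in auto)
  qed
  note side = side[OF lim(1) assms(4)] side[OF lim(2) assms(5)]
  have lim1: "((\<lambda>c. (?x c - 1) - (1 - 1 / ?y c)) \<longlongrightarrow> (?x a - 1) - (1 - 1 / ?y a)) (nhds a)"
    and lim2: "((\<lambda>c. (1 - 1 / ?x c) - (?y c - 1)) \<longlongrightarrow> (1 - 1 / ?x a) - (?y a - 1)) (nhds a)"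
    using pos by (auto intro!: tendsto_intros lim)
  consider "?x a > 1" "?y a > 1" | "?x a < 1" "?y a < 1" | "?x a > 1" "?y a < 1" | "?x a < 1" "?y a > 1"
    using assms(4,5) by linarith
  then show ?thesis
  proof cases
    case 1
    then have "\<forall>\<^sub>F c in nhds a. (?x c - 1) - (1 - 1 / ?y c) \<noteq> 0"
      using assms(6) by (intro tendsto_imp_eventually_ne[OF lim1]) (auto simp: separated_def)
    with side show ?thesis by eventually_elim (use 1 in \<open>auto simp: separated_def\<close>)
  next
    case 2
    then have "\<forall>\<^sub>F c in nhds a. (1 - 1 / ?x c) - (?y c - 1) \<noteq> 0"
      using assms(6) by (intro tendsto_imp_eventually_ne[OF lim2]) (auto simp: separated_def)
    with side show ?thesis by eventually_elim (use 2 in \<open>auto simp: separated_def\<close>)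
  next
    case 3
    show ?thesis using side by eventually_elim (use 3 in \<open>auto simp: separated_def\<close>)
  next
    case 4
    show ?thesis using side by eventually_elim (use 4 in \<open>auto simp: separated_def\<close>)
  qed
qed

definition clean_set :: "(real \<times> real) set" where
  "clean_set = {(a, b). a < 0 \<and> clean_exit a b}"

lemma open_clean_set: "open clean_set"
proof -
  have "\<forall>\<^sub>F p in nhds (a, b). p \<in> clean_set" if ab: "(a, b) \<in> clean_set" for a b
  proof -
    obtain n where a: "a < 0" and n: "1 / (1 - a) < farey_orbit a n" "farey_orbit a n < 1 + b"
      "farey_orbit a n \<noteq> 1" "\<forall>i\<le>n. \<forall>j<i. separated a i j"
      using ab by (auto simp: clean_set_def clean_exit_def)
    have ne1: "farey_orbit a i \<noteq> 1" if "i \<le> n" for i using farey_orbit_ne_1[OF n(3) that] .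
    have lim: "((\<lambda>c. farey_orbit c i) \<longlongrightarrow> farey_orbit a i) (nhds a)" if "i \<le> n" for i
      using isCont_farey_orbit[OF a, of i] ne1 that
        tendsto_at_iff_tendsto_nhds[of "\<lambda>c. farey_orbit c i" a]
      by (simp add: isCont_def)
    have "\<forall>\<^sub>F c in nhds a. \<forall>i\<in>{..n}. \<forall>j\<in>{..<i}. separated c i j"
      using eventually_separated[OF lim lim a ne1 ne1] n(4)
      by (intro eventually_ball_finite ballI) auto
    moreover have "\<forall>\<^sub>F c in nhds a. farey_orbit c n \<noteq> 1"
      by (rule tendsto_imp_eventually_ne[OF lim n(3)]) simp
    moreover have "\<forall>\<^sub>F c in nhds a. farey_orbit c n - 1 / (1 - c) > 0"
      by (rule order_tendstoD(1)[of _ "farey_orbit a n - 1 / (1 - a)"])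
        (use a n in \<open>auto intro!: tendsto_intros lim filterlim_ident\<close>)
    moreover have "\<forall>\<^sub>F c in nhds a. c < 0" using a by (rule order_tendstoD(2)[OF filterlim_ident])
    ultimately have 1: "\<forall>\<^sub>F c in nhds a. c < 0 \<and> (\<forall>i\<le>n. \<forall>j<i. separated c i j) \<and>
        farey_orbit c n \<noteq> 1 \<and> 1 / (1 - c) < farey_orbit c n"
      by eventually_elim auto
    have "(fst \<longlongrightarrow> a) (nhds (a, b))"
      using tendsto_fst[OF filterlim_ident, of "(a, b)"] by simp
    with 1 have 2: "\<forall>\<^sub>F p in nhds (a, b). fst p < 0 \<and> (\<forall>i\<le>n. \<forall>j<i. separated (fst p) i j) \<and>
        farey_orbit (fst p) n \<noteq> 1 \<and> 1 / (1 - fst p) < farey_orbit (fst p) n"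
      unfolding filterlim_iff by blast
    have "((\<lambda>p. 1 + snd p - farey_orbit (fst p) n) \<longlongrightarrow> 1 + b - farey_orbit a n) (nhds (a, b))"
      using tendsto_snd[OF filterlim_ident, of "(a, b)"] \<open>(fst \<longlongrightarrow> a) (nhds (a, b))\<close>
      by (auto intro!: tendsto_intros filterlim_compose[OF lim])
    then have "\<forall>\<^sub>F p in nhds (a, b). 1 + snd p - farey_orbit (fst p) n > 0"
      by (rule order_tendstoD(1)) (use n in simp)
    with 2 show ?thesis
      by eventually_elim (auto simp: clean_set_def clean_exit_def)
  qed
  then show ?thesis by (subst open_subopen) (force simp: eventually_nhds)
qed

section \<open>The clean exit condition is dense\<close>

text \<open>By Euclid's algorithm the Farey orbit of \<open>p/q\<close> reaches \<open>1\<close> after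
  finitely many steps. The inverse branches \<open>x \<mapsto> x + 1\<close> and \<open>x \<mapsto> x/(1 +
  x)\<close> do not increase distances, so that a perturbation of \<open>1\<close> can be pulled back to one
  of \<open>p/q\<close>.\<close>

lemma farey_rational_near_1:
  fixes p q :: nat and \<epsilon> \<eta> :: real
  assumes "0 < p" "0 < q" "0 < \<epsilon>" "0 < \<eta>"
  shows "\<exists>x\<in>\<rat>. 0 < x \<and> \<bar>x - p / q\<bar> < \<epsilon> \<and> (\<exists>n. (farey ^^ n) x \<noteq> 1 \<and> \<bar>(farey ^^ n) x - 1\<bar> < \<eta>)"
  using assms(1,2)
proof (induction "p + q" arbitrary: p q rule: less_induct)
  case less
  consider "p = q" | "q < p" | "p < q" by linarith
  then show ?case
  proof cases
    case 1
    obtain x where "x \<in> \<rat>" "1 < x" "x < 1 + min \<epsilon> \<eta>"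
      using Rats_dense_in_real[of 1 "1 + min \<epsilon> \<eta>"] assms(3,4) by auto
    then show ?thesis using 1 less.prems by (intro bexI[of _ x] conjI exI[of _ 0]) auto
  next
    case 2
    then obtain x n where x: "x \<in> \<rat>" "0 < x" "\<bar>x - real (p - q) / q\<bar> < \<epsilon>"
      and n: "(farey ^^ n) x \<noteq> 1" "\<bar>(farey ^^ n) x - 1\<bar> < \<eta>"
      using less.hyps[of "p - q" q] less.prems by auto
    have "(x + 1) - p / q = x - real (p - q) / q"
      using 2 less.prems by (simp add: of_nat_diff field_simps)
    moreover have "(farey ^^ Suc n) (x + 1) = (farey ^^ n) x"
      using x by (simp only: funpow_Suc_right comp_apply) (simp add: farey_def)
    ultimately show ?thesis
      using x n by (intro bexI[of _ "x + 1"] conjI exI[of _ "Suc n"]) auto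
  next
    case 3
    then obtain x n where x: "x \<in> \<rat>" "0 < x" "\<bar>x - p / real (q - p)\<bar> < \<epsilon>"
      and n: "(farey ^^ n) x \<noteq> 1" "\<bar>(farey ^^ n) x - 1\<bar> < \<eta>"
      using less.hyps[of p "q - p"] less.prems by auto
    define w where "w = p / real (q - p)"
    have w: "0 < w" "p / q = w / (1 + w)"
      using 3 less.prems by (auto simp: w_def of_nat_diff field_simps)
    have "x / (1 + x) - w / (1 + w) = (x - w) / ((1 + x) * (1 + w))"
      using x(2) w(1) by (simp add: divide_simps) (simp add: algebra_simps)
    moreover have "(1 + x) * (1 + w) \<ge> 1"
      using x(2) w(1) by (simp add: algebra_simps)
    then have "\<bar>(x - w) / ((1 + x) * (1 + w))\<bar> \<le> \<bar>x - w\<bar>"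
      by (simp add: abs_divide divide_le_eq mult_le_cancel_left1)
    moreover have "\<bar>x - w\<bar> < \<epsilon>" using x(3) by (simp add: w_def)
    ultimately have "\<bar>x / (1 + x) - p / q\<bar> < \<epsilon>" unfolding w(2) by linarith
    moreover have "x / (1 + x) < 1" "1 - x / (1 + x) = 1 / (1 + x)"
      using x(2) by (simp_all add: field_simps)
    then have "farey (x / (1 + x)) = x" using x(2) by (simp add: farey_def)
    then have "(farey ^^ Suc n) (x / (1 + x)) = (farey ^^ n) x"
      by (simp only: funpow_Suc_right comp_apply)
    ultimately show ?thesis
      using x n by (intro bexI[of _ "x / (1 + x)"] conjI exI[of _ "Suc n"]) auto
  qed
qed

lemma farey_orbit_height_decreases:
  assumes "farey_orbit a j = real p / real q" "0 < p" "0 < q" "j < i"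
    and "\<And>l. l < i \<Longrightarrow> farey_orbit a l \<noteq> 1"
  shows "\<exists>p' q'. 0 < p' \<and> 0 < q' \<and> farey_orbit a i = real p' / real q' \<and> p' + q' < p + q"
proof -
  have one: "\<exists>p' q'. 0 < p' \<and> 0 < q' \<and> farey_orbit a (Suc l) = real p' / real q' \<and> p' + q' < p + q"
    if l: "farey_orbit a l = real p / real q" "0 < p" "0 < q" "farey_orbit a l \<noteq> 1" for l p q
  proof -
    have "p \<noteq> q" using l by auto
    then consider "q < p" | "p < q" by linarith
    then show ?thesis
    proof cases
      case 1
      have "farey_orbit a l > 1" unfolding l(1) using 1 l(3) by simp
      then have "farey_orbit a (Suc l) = p / q - 1" by (simp add: farey_orbit_simps farey_def l(1))
      then have "farey_orbit a (Suc l) = real (p - q) / real q"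
        using 1 l(3) by (simp add: of_nat_diff field_simps)
      moreover have "0 < p - q" "p - q + q < p + q" using 1 l(3) by simp_all
      ultimately show ?thesis using l(3) by blast
    next
      case 2
      have "farey_orbit a l < 1" unfolding l(1) using 2 l(2) by simp
      then have "farey_orbit a (Suc l) = (p / q) / (1 - p / q)"
        by (simp add: farey_orbit_simps farey_def l(1))
      then have "farey_orbit a (Suc l) = real p / real (q - p)"
        using 2 l(3) by (simp add: of_nat_diff field_simps)
      moreover have "0 < q - p" "p + (q - p) < p + q" using 2 l(2) by simp_all
      ultimately show ?thesis using l(2) by blast
    qed
  qed
  from assms(4) have "Suc j \<le> i" by simp
  then show ?thesis using assms(5)
  proof (induction i rule: dec_induct)
    case base then show ?case using one[OF assms(1-3)] by simp
  next
    case (step l)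
    then obtain p' q' where "0 < p'" "0 < q'" "farey_orbit a l = real p' / real q'" "p' + q' < p + q" by auto
    then show ?case using one[of l p' q'] step.prems[of l] by (meson lessI less_trans)
  qed
qed

lemma farey_orbit_Rats: "- 1 / a \<in> \<rat> \<Longrightarrow> farey_orbit a i \<in> \<rat>"
  by (induction i) (auto simp: farey_orbit_simps farey_def)

text \<open>Let \<open>X j = p/q\<close> in lowest terms. The coincidence \<open>X i = 2 - 1/X j\<close>
  forces the denominator of \<open>X i\<close> to be a multiple of \<open>p\<close>, and \<open>X j = 2 -
  1/X i\<close> forces its numerator to be a multiple of \<open>q\<close>. Given the positions relative to
  \<open>1\<close>, numerator plus denominator of \<open>X i\<close> would exceed \<open>p +
  q\<close>.\<close>

lemma separated_if_rational:
  assumes rat: "- 1 / a \<in> \<rat>" and a: "a < 0" and ji: "j < i" and ne1: "farey_orbit a i \<noteq> 1"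
  shows "separated a i j"
proof -
  let ?x = "farey_orbit a i" and ?y = "farey_orbit a j"
  have pos: "?y > 0" using farey_orbit_pos[OF a] .
  obtain p q :: nat where q: "q \<noteq> 0" and pq: "\<bar>?y\<bar> = real p / real q" "coprime p q"
    using Rats_abs_nat_div_natE[OF farey_orbit_Rats[OF rat]] by blast
  have y: "?y = real p / real q" using pq pos by simp
  have q0: "0 < q" using q by simp
  have p0: "0 < p" using y pos by (cases p) auto
  have "farey_orbit a l \<noteq> 1" if "l < i" for l using farey_orbit_ne_1[OF ne1, of l] that by simp
  then obtain p' q' where pq': "0 < p'" "0 < q'" "?x = real p' / real q'" "p' + q' < p + q"
    using farey_orbit_height_decreases[OF y p0 q0 ji] by blast
  have "?x - 1 \<noteq> 1 - 1 / ?y" if "?x > 1" "?y > 1"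
  proof
    assume "?x - 1 = 1 - 1 / ?y"
    then have "real (p' * p + q * q') = real (2 * p * q')"
      using pq'(1-3) p0 q0 unfolding y by (simp add: field_simps)
    then have "p' * p + q * q' = 2 * p * q'" by (simp only: of_nat_eq_iff)
    then have "p dvd p' * p + q * q'" by simp
    then have "p dvd q * q'" by (simp add: dvd_add_right_iff)
    then have "p dvd q'" using pq(2) by (simp add: coprime_dvd_mult_right_iff)
    then have "p \<le> q'" using pq'(2) by (rule dvd_imp_le)
    moreover have "q' < p'" "q < p" using that pq' y q0 by (simp_all add: field_simps)
    ultimately show False using pq'(4) by linarith
  qed
  moreover have "1 - 1 / ?x \<noteq> ?y - 1" if "?x < 1" "?y < 1"
  proof
    assume "1 - 1 / ?x = ?y - 1"
    then have "real (p' * p + q * q') = real (q * (2 * p'))"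
      using pq'(1-3) p0 q0 unfolding y by (simp add: field_simps)
    then have "p' * p + q * q' = q * (2 * p')" by (simp only: of_nat_eq_iff)
    then have "q dvd p' * p + q * q'" by simp
    then have "q dvd p' * p" by (simp add: dvd_add_left_iff)
    then have "q dvd p'" using pq(2) by (simp add: coprime_dvd_mult_left_iff coprime_commute)
    then have "q \<le> p'" using pq'(1) by (rule dvd_imp_le)
    moreover have "p' < q'" "p < q" using that pq' y q0 by (simp_all add: field_simps)
    ultimately show False using pq'(4) by linarith
  qed
  ultimately show ?thesis by (simp add: separated_def)
qed

text \<open>It suffices to move \<open>a\<close>. The number \<open>\<eta>\<close> is chosen such that
  \<open>(1 - \<eta>, 1 + \<eta>)\<close> lies in the hole for all parameters near \<open>a\<close>.\<close>

lemma clean_set_dense_near: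
  assumes "open W" "(a, b) \<in> W" "a < 0" "0 < b"
  shows "\<exists>c. (c, b) \<in> W \<inter> clean_set"
proof -
  define x where "x = - 1 / a"
  have x: "0 < x" "- 1 / x = a" using assms(3) by (auto simp: x_def)
  define \<eta> where "\<eta> = min b (1 / (2 * (1 + x)))"
  have eta: "0 < \<eta>" using assms(4) x by (simp add: \<eta>_def)
  have "((\<lambda>z. (- 1 / z, b)) \<longlongrightarrow> (- 1 / x, b)) (nhds x)"
    using x by (auto intro!: tendsto_intros filterlim_ident)
  then have e1: "\<forall>\<^sub>F z in nhds x. (- 1 / z, b) \<in> W"
    using assms(1,2) x(2) by (simp add: topological_tendstoD)
  have "((\<lambda>z. 1 - 1 / (1 + z)) \<longlongrightarrow> 1 - 1 / (1 + x)) (nhds x)"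
    using x by (auto intro!: tendsto_intros filterlim_ident)
  moreover have "1 - 1 / (1 + x) < 1 - \<eta>"
  proof -
    have "1 / (2 * (1 + x)) < 1 / (1 + x)" using x by (simp add: field_simps)
    then show ?thesis unfolding \<eta>_def by linarith
  qed
  ultimately have e2: "\<forall>\<^sub>F z in nhds x. 1 - 1 / (1 + z) < 1 - \<eta>" by (rule order_tendstoD(2))
  obtain \<delta> where \<delta>: "0 < \<delta>" "\<And>z. dist z x < \<delta> \<Longrightarrow> (- 1 / z, b) \<in> W \<and> 1 - 1 / (1 + z) < 1 - \<eta>"
    using eventually_conj[OF e1 e2] unfolding eventually_nhds_metric by blast
  obtain r where r: "r \<in> \<rat>" "x < r" "r < x + \<delta> / 2"
    using Rats_dense_in_real[of x "x + \<delta> / 2"] \<delta>(1) by auto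
  obtain p q :: nat where pq: "q \<noteq> 0" "\<bar>r\<bar> = real p / real q" "coprime p q"
    using Rats_abs_nat_div_natE[OF r(1)] by blast
  have req: "r = real p / real q" using pq r x by simp
  have p0: "0 < p" using req r x by (cases p) auto
  obtain z n where z: "z \<in> \<rat>" "0 < z" "\<bar>z - r\<bar> < \<delta> / 2"
    and n: "(farey ^^ n) z \<noteq> 1" "\<bar>(farey ^^ n) z - 1\<bar> < \<eta>"
    using farey_rational_near_1[of p q "\<delta> / 2" \<eta>] p0 pq(1) \<delta>(1) eta req by auto
  define c where "c = - 1 / z"
  have c: "c < 0" "- 1 / c = z" using z by (auto simp: c_def)
  have Xn: "farey_orbit c n = (farey ^^ n) z" by (simp only: farey_orbit_def c(2))
  have "dist z x < \<delta>" using z(3) r(2,3) unfolding dist_real_def by linarith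
  note zW = \<delta>(2)[OF this]
  have "1 / (1 - c) = 1 - 1 / (1 + z)" using z by (simp add: c_def field_simps)
  then have "1 / (1 - c) < farey_orbit c n" using zW n(2) Xn by linarith
  moreover have "farey_orbit c n < 1 + b" using n(2) Xn by (auto simp: \<eta>_def)
  moreover have "farey_orbit c n \<noteq> 1" using n Xn by simp
  moreover from this have "\<forall>i\<le>n. \<forall>j<i. separated c i j"
    using separated_if_rational[of c, unfolded c(2), OF z(1) c(1)] farey_orbit_ne_1[of c n] by blast
  ultimately have "clean_exit c b" unfolding clean_exit_def by blast
  then have "(c, b) \<in> W \<inter> clean_set" using zW c by (simp add: clean_set_def c_def)
  then show ?thesis ..
qed

section \<open>The parameter set\<close>

definition P_interior :: "(real \<times> real) set" where
  "P_interior = {(a, b). a < 0 \<and> 0 < b \<and> b - a > 1 \<and> - (a * b) < 1}"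

lemma P_interior_subset: "P_interior \<subseteq> P_set"
  by (auto simp: P_interior_def P_set_def)

lemma open_P_interior: "open P_interior"
proof -
  have "P_interior = {p. fst p < 0} \<inter> {p. 0 < snd p} \<inter> {p. 1 < snd p - fst p} \<inter>
      {p. - (fst p * snd p) < 1}"
    by (auto simp: P_interior_def)
  also have "open \<dots>" by (intro open_Int open_Collect_less continuous_intros)
  finally show ?thesis .
qed

text \<open>If \<open>-ab < 1\<close>, move \<open>a\<close> and \<open>b\<close> away from
  \<open>0\<close>. On the hyperbola \<open>-ab = 1\<close> move them towards \<open>0\<close>; there is
  room for this because \<open>b - a \<ge> 2\<close> by the inequality of arithmetic and geometric
  means.\<close>

lemma P_interior_dense:
  assumes "(a, b) \<in> P_set" "open W" "(a, b) \<in> W"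
  shows "W \<inter> P_interior \<noteq> {}"
proof -
  have P: "a \<le> 0" "0 \<le> b" "1 \<le> b - a" "- (a * b) \<le> 1" using assms(1) by (auto simp: P_set_def)
  have pos: "\<forall>\<^sub>F e in at_right 0. e > (0::real)" by (rule eventually_at_right_less)
  have lim_id: "((\<lambda>e. e) \<longlongrightarrow> (0::real)) (at_right 0)" by (rule tendsto_ident_at)
  have "\<exists>\<gamma>. (\<gamma> \<longlongrightarrow> (a, b)) (at_right (0::real)) \<and> (\<forall>\<^sub>F e in at_right 0. \<gamma> e \<in> P_interior)"
  proof (cases "- (a * b) < 1")
    case True
    have l: "((\<lambda>e. (a - e, b + e)) \<longlongrightarrow> (a - 0, b + 0)) (at_right (0::real))"
      by (intro tendsto_intros lim_id)
    have "((\<lambda>e. - ((a - e) * (b + e))) \<longlongrightarrow> - ((a - 0) * (b + 0))) (at_right (0::real))"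
      by (intro tendsto_intros lim_id)
    then have "\<forall>\<^sub>F e in at_right (0::real). - ((a - e) * (b + e)) < 1"
      by (rule order_tendstoD(2)) (use True in simp)
    with pos have "\<forall>\<^sub>F e in at_right 0. (a - e, b + e) \<in> P_interior"
      by eventually_elim (use P in \<open>auto simp: P_interior_def\<close>)
    then show ?thesis using l by auto
  next
    case False
    then have ab: "a * b = - 1" using P by simp
    then have ab0: "a < 0" "0 < b" using P by (auto simp: less_le)
    have "(b - a)\<^sup>2 = (b + a)\<^sup>2 + 4" using ab by (simp add: power2_eq_square algebra_simps)
    then have "2\<^sup>2 \<le> (b - a)\<^sup>2" by simp
    then have gap: "2 \<le> b - a" by (rule power2_le_imp_le) (use P in simp)
    have l: "((\<lambda>e. (a + e, b - e)) \<longlongrightarrow> (a + 0, b - 0)) (at_right (0::real))"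
      by (intro tendsto_intros lim_id)
    have "\<forall>\<^sub>F e in at_right (0::real). e < min (1 / 4) (min (- a) b)"
      by (rule order_tendstoD(2)[OF lim_id]) (use ab0 in simp)
    with pos have "\<forall>\<^sub>F e in at_right 0. (a + e, b - e) \<in> P_interior"
    proof eventually_elim
      case (elim e)
      have "- ((a + e) * (b - e)) = 1 - e * (b - a - e)" using ab by (simp add: algebra_simps)
      moreover have "0 < e * (b - a - e)" using elim gap by simp
      ultimately have "- ((a + e) * (b - e)) < 1" by linarith
      then show ?case using elim gap by (auto simp: P_interior_def)
    qed
    then show ?thesis using l by auto
  qed
  then obtain \<gamma> where g: "(\<gamma> \<longlongrightarrow> (a, b)) (at_right (0::real))" "\<forall>\<^sub>F e in at_right 0. \<gamma> e \<in> P_interior"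
    by blast
  have "\<forall>\<^sub>F e in at_right 0. \<gamma> e \<in> W" using g(1) assms(2,3) by (rule topological_tendstoD)
  with g(2) have "\<forall>\<^sub>F e in at_right 0. \<gamma> e \<in> W \<inter> P_interior" by eventually_elim simp
  then show ?thesis using eventually_happens'[OF trivial_limit_at_right_real] by blast
qed

text \<open>The effect of \<open>mirror\<close> on the parameters; it interchanges the two cycle properties.\<close>

definition swap_params :: "real \<times> real \<Rightarrow> real \<times> real" where
  "swap_params p = (- snd p, - fst p)"

lemma open_vimage_swap: "open W \<Longrightarrow> open (swap_params -` W)"
  unfolding swap_params_def by (intro open_vimage continuous_intros)

lemma swap_swap: "swap_params (swap_params p) = p"
  by (simp add: swap_params_def)

lemma strong_cycle_a_iff:
  assumes "(a, b) \<in> P_set"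
  shows "strong_cycle_a a b \<longleftrightarrow> (a, b) \<in> clean_set"
proof (cases "a < 0")
  case True
  then interpret cf_params a b by unfold_locales (use assms in \<open>auto simp: P_set_def\<close>)
  show ?thesis using strong_cycle_a_iff_clean_exit True by (simp add: clean_set_def)
next
  case False
  then show ?thesis using assms not_strong_cycle_a_zero[of b] by (auto simp: P_set_def clean_set_def)
qed

lemma strong_cycle_b_iff:
  assumes "(a, b) \<in> P_set"
  shows "strong_cycle_b a b \<longleftrightarrow> swap_params (a, b) \<in> clean_set"
proof -
  have "(- b, - a) \<in> P_set" "a < b" using assms by (auto simp: P_set_def mult.commute)
  then show ?thesis using strong_cycle_b_iff_mirror strong_cycle_a_iff by (simp add: swap_params_def)
qed

lemma strong_cycle_set_eq: "strong_cycle_set = P_set \<inter> (clean_set \<inter> swap_params -` clean_set)"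
  using strong_cycle_a_iff strong_cycle_b_iff by (auto simp: strong_cycle_set_def)

theorem proposition8p12:
  shows "openin (top_of_set P_set) strong_cycle_set \<and>
         (top_of_set P_set) closure_of strong_cycle_set = P_set"
proof
  have "open (clean_set \<inter> swap_params -` clean_set)"
    by (intro open_Int open_clean_set open_vimage_swap)
  then show "openin (top_of_set P_set) strong_cycle_set"
    unfolding strong_cycle_set_eq by (rule openin_open_Int)
  have meets: "W \<inter> strong_cycle_set \<noteq> {}" if W: "open W" "p \<in> W" "p \<in> P_set" for W p
  proof -
    obtain a b where 1: "(a, b) \<in> W \<inter> P_interior"
      using P_interior_dense[of "fst p" "snd p" W] W by force
    have "open (W \<inter> P_interior)" using W(1) open_P_interior by blast
    then obtain c where 2: "(c, b) \<in> W \<inter> P_interior \<inter> clean_set"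
      using clean_set_dense_near[of "W \<inter> P_interior" a b] 1 by (auto simp: P_interior_def)
    have "open (W \<inter> P_interior \<inter> clean_set)" using W(1) open_P_interior open_clean_set by blast
    then have "open (swap_params -` (W \<inter> P_interior \<inter> clean_set))" by (rule open_vimage_swap)
    moreover have "(- b, - c) \<in> swap_params -` (W \<inter> P_interior \<inter> clean_set)"
      using 2 by (simp add: swap_params_def)
    ultimately obtain d where
      d: "(d, - c) \<in> swap_params -` (W \<inter> P_interior \<inter> clean_set) \<inter> clean_set"
      using clean_set_dense_near 2 by (fastforce simp: P_interior_def)
    then have "swap_params (d, - c) \<in> W \<inter> strong_cycle_set"
      using P_interior_subset by (auto simp: strong_cycle_set_eq swap_swap)
    then show ?thesis by blast
  qed
  have "P_set \<subseteq> closure strong_cycle_set"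
    using meets by (auto simp: closure_iff_nhds_not_empty) (metis inf_commute subset_eq disjoint_iff)
  then show "(top_of_set P_set) closure_of strong_cycle_set = P_set"
    by (auto simp: closure_of_subtopology Int_absorb1 strong_cycle_set_eq)
qed

end
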